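(* Let $L=(L_t)_{t\in\mathbb{R}}$ be a two-sided Lévy process in $\mathbb{R}^d$ with $\mathbb{E}[L_1]=0$ and generating triplet $(\gamma,\Sigma,\nu)$. Assume that $\nu$ is regularly varying with index $\alpha\in(1,2]$, and let $M$ be the associated regularly varying random content $$M(A)=\frac{1}{\sqrt{2\pi}}\int_{-\infty}^{\infty}\widehat{1_A}(\mu)\,L(d\mu),\qquad A\in\mathcal{E}(\mathbb{R}).$$ Then $M$ is neither independently scattered nor stationarily scattered.
   Context: $\mathcal{E}(\mathbb{R})$ is the ring generated by the half-open bounded intervals $[a,b)$, $-\infty<a<b<\infty$. $\widehat{1_A}(\mu)=\frac{1}{\sqrt{2\pi}}\int_Ae^{-i\mu x}dx$. $M$ is independently scattered if $M(A_1),\dots,M(A_n)$ are independent whenever $A_1,\dots,A_n\in\mathcal{E}(\mathbb{R})$ are pairwise disjoint. $M$ is stationarily scattered if for every $\tau\in\mathbb{R}$ the families $\{M(A):A\in\mathcal{E}(\mathbb{R})\}$ and $\{M(A+\tau):A\in\mathcal{E}(\mathbb{R})\}$ have the same finite-dimensional distributions. Two-sided Lévy process: $L_0=0$ a.s., independent stationary increments, $\mathbb{E}[e^{i\langle z,L_t\rangle}]=\exp\{|t|\psi_L(\mathrm{sgn}(t)z)\}$, $\psi_L(z)=i\langle\gamma,z\rangle-\tfrac12\langle z,\Sigma z\rangle+\int_{\mathbb{R}^d}(e^{i\langle z,x\rangle}-1-i\langle z,x\rangle1_{[0,1]}(\|x\|))\nu(dx)$; $(\gamma,\Sigma,\nu)$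 is the generating triplet, $\nu$ the Lévy measure. A Radon measure $\nu$ is regularly varying with index $\alpha>0$ if there are $l:\mathbb{R}\to\mathbb{R}$ slowly varying at infinity and a non-zero Radon measure $\kappa$ on $[-\infty,\infty]^d\setminus\{0\}$ with $\kappa([-\infty,\infty]^d\setminus\mathbb{R}^d)=0$ such that $u^\alpha l(u)\nu(u\,\cdot)\to\kappa(\cdot)$ vaguely on $[-\infty,\infty]^d\setminus\{0\}$ as $u\to\infty$ (relatively compact sets are those bounded away from $0$). Integrals with respect to $L$ are in the sense of Rajput and Rosiński: $L$ defines an independently scattered random measure on bounded Borel sets via $L([a,b))=L_b-L_a$; for simple $f=\sum_if_i1_{A_i}$, $\int_Af\,dL=\sum_if_iL(A_i\cap A)$; a measurable $f$ is $L$-integrable if there are simple $f_n\to f$ Lebesgue-a.e. with $\int_Af_n\,dL$ convergent in probability for every Borel set $A$, and $\int_Af\,dL$ is the limit. Complex integrands are handled by identifying $\mathbb{C}$ with $\mathbb{R}^2$. Bounded measurable functions in $L^\delta$ for some $\delta<\alpha$ are $L$-integrable, so $M$ is well defined. *)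

theory Defs
  imports "HOL-Probability.Probability"
begin

text \<open>Vectors in \<open>\<real>\<^sup>d\<close> are \<open>real ^ 'n\<close>, vectors in \<open>\<complex>\<^sup>d\<close> are \<open>complex ^ 'n\<close>, and
  \<open>[-\<infinity>,\<infinity>]\<^sup>d\<close> is \<open>ereal ^ 'n\<close> with the product topology.\<close>

section \<open>Levy processes\<close>

definition levy_measure :: "(real ^ 'n) measure \<Rightarrow> bool" where
  "levy_measure \<nu> \<longleftrightarrow>
     sets \<nu> = sets borel \<and> emeasure \<nu> {0} = 0 \<and>
     (\<integral>\<^sup>+x. ennreal (min 1 ((norm x)\<^sup>2)) \<partial>\<nu>) < \<infinity>"

definition generating_triplet :: "real ^ 'n \<Rightarrow> real ^ 'n ^ 'n \<Rightarrow> (real ^ 'n) measure \<Rightarrow> bool" where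
  "generating_triplet \<gamma> S \<nu> \<longleftrightarrow>
     transpose S = S \<and> (\<forall>z. 0 \<le> z \<bullet> (S *v z)) \<and> levy_measure \<nu>"

definition levy_exponent ::
  "real ^ 'n \<Rightarrow> real ^ 'n ^ 'n \<Rightarrow> (real ^ 'n) measure \<Rightarrow> real ^ 'n \<Rightarrow> complex" where
  "levy_exponent \<gamma> S \<nu> z =
     \<i> * of_real (\<gamma> \<bullet> z) - of_real (z \<bullet> (S *v z)) / 2 +
     (CLINT x|\<nu>. exp (\<i> * of_real (z \<bullet> x)) - 1
        - \<i> * of_real (z \<bullet> x) * indicator {0..1} (norm x))"

definition two_sided_levy_process ::
  "'a measure \<Rightarrow> (real \<Rightarrow> 'a \<Rightarrow> real ^ 'n) \<Rightarrow>
   real ^ 'n \<Rightarrow> real ^ 'n ^ 'n \<Rightarrow> (real ^ 'n) measure \<Rightarrow> bool" where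
  "two_sided_levy_process P L \<gamma> S \<nu> \<longleftrightarrow>
     prob_space P \<and> generating_triplet \<gamma> S \<nu> \<and>
     (\<forall>t. L t \<in> borel_measurable P) \<and>
     (AE \<omega> in P. L 0 \<omega> = 0) \<and>
     (\<forall>(n::nat) t. (\<forall>i<n. t i < t (Suc i)) \<longrightarrow>
        prob_space.indep_vars P (\<lambda>_. borel) (\<lambda>i \<omega>. L (t (Suc i)) \<omega> - L (t i) \<omega>) {..<n}) \<and>
     (\<forall>s t h. s \<le> t \<longrightarrow>
        distr P borel (\<lambda>\<omega>. L (t + h) \<omega> - L (s + h) \<omega>) = distr P borel (\<lambda>\<omega>. L t \<omega> - L s \<omega>)) \<and>
     (\<forall>t z. (CLINT \<omega>|P. exp (\<i> * of_real (z \<bullet> L t \<omega>))) =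
        exp (of_real \<bar>t\<bar> * levy_exponent \<gamma> S \<nu> (sgn t *\<^sub>R z)))"


section \<open>Regular variation of measures\<close>

definition slowly_varying :: "(real \<Rightarrow> real) \<Rightarrow> bool" where
  "slowly_varying l \<longleftrightarrow>
     (\<exists>X. l \<in> borel_measurable (restrict_space borel {X..}) \<and> (\<forall>x\<ge>X. l x > 0)) \<and>
     (\<forall>c>0. ((\<lambda>u. l (c * u) / l u) \<longlongrightarrow> 1) at_top)"

text \<open>Measures on a Borel subset \<open>X\<close> of a (locally compact, second countable) space are
  represented by Borel measures on the whole space that vanish outside \<open>X\<close>.\<close>

definition radon_measure_on :: "'b::topological_space set \<Rightarrow> 'b measure \<Rightarrow> bool" where
  "radon_measure_on X \<mu> \<longleftrightarrow>
     sets \<mu> = sets borel \<and> emeasure \<mu> (- X) = 0 \<and>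
     (\<forall>K. compact K \<and> K \<subseteq> X \<longrightarrow> emeasure \<mu> K < \<infinity>)"

definition vaguely_tendsto_on ::
  "'b::topological_space set \<Rightarrow> ('c \<Rightarrow> 'b measure) \<Rightarrow> 'b measure \<Rightarrow> 'c filter \<Rightarrow> bool" where
  "vaguely_tendsto_on X \<mu> \<kappa> F \<longleftrightarrow>
     (\<forall>f::'b \<Rightarrow> real. continuous_on X f \<and> (\<exists>K. compact K \<and> K \<subseteq> X \<and> (\<forall>x. x \<notin> K \<longrightarrow> f x = 0)) \<longrightarrow>
        ((\<lambda>u. LINT x|\<mu> u. f x) \<longlongrightarrow> (LINT x|\<kappa>. f x)) F)"

definition ereal_vec :: "real ^ 'n \<Rightarrow> ereal ^ 'n" where
  "ereal_vec x = (\<chi> i. ereal (x $ i))"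

text \<open>For \<open>u > 0\<close>, the measure \<open>\<nu>(u \<cdot>)\<close> on \<open>[-\<infinity>,\<infinity>]\<^sup>d\<close> is the image of \<open>\<nu>\<close> under \<open>x \<mapsto> x / u\<close>.
  The conversion \<open>ennreal\<close> is harmless because \<open>u\<^sup>\<alpha> l(u) > 0\<close> for all large \<open>u\<close>.\<close>

definition regularly_varying_measure :: "(real ^ 'n) measure \<Rightarrow> real \<Rightarrow> bool" where
  "regularly_varying_measure \<nu> \<alpha> \<longleftrightarrow>
     0 < \<alpha> \<and> sets \<nu> = sets borel \<and> radon_measure_on (- {0}) (distr \<nu> borel ereal_vec) \<and>
     (\<exists>l (\<kappa> :: (ereal ^ 'n) measure).
        slowly_varying l \<and> radon_measure_on (- {0}) \<kappa> \<and>
        emeasure \<kappa> (- {0}) \<noteq> 0 \<and> emeasure \<kappa> (- range ereal_vec) = 0 \<and>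
        vaguely_tendsto_on (- {0})
          (\<lambda>u. scale_measure (ennreal (u powr \<alpha> * l u))
                 (distr \<nu> borel (\<lambda>x. ereal_vec (inverse u *\<^sub>R x)))) \<kappa> at_top)"


section \<open>Integration with respect to a two-sided Levy process\<close>

definition tendsto_in_prob ::
  "'a measure \<Rightarrow> (nat \<Rightarrow> 'a \<Rightarrow> 'b::metric_space) \<Rightarrow> ('a \<Rightarrow> 'b) \<Rightarrow> bool" where
  "tendsto_in_prob P X Y \<longleftrightarrow>
     (\<forall>\<epsilon>>0. (\<lambda>n. measure P {\<omega> \<in> space P. dist (X n \<omega>) (Y \<omega>) > \<epsilon>}) \<longlonglongrightarrow> 0)"

definition bounded_borel :: "real set set" where
  "bounded_borel = {B \<in> sets borel. bounded B}"

text \<open>\<open>\<Lambda>\<close> is the independently scattered random measure on the bounded Borel sets with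
  \<open>\<Lambda> [a,b) = L\<^sub>b - L\<^sub>a\<close>; it is unique up to almost sure equality of each \<open>\<Lambda> B\<close>.\<close>

definition levy_random_measure ::
  "'a measure \<Rightarrow> (real \<Rightarrow> 'a \<Rightarrow> real ^ 'n) \<Rightarrow> (real set \<Rightarrow> 'a \<Rightarrow> real ^ 'n) \<Rightarrow> bool" where
  "levy_random_measure P L \<Lambda> \<longleftrightarrow>
     (\<forall>B \<in> bounded_borel. \<Lambda> B \<in> borel_measurable P) \<and>
     (\<forall>(n::nat) B. (\<forall>i<n. B i \<in> bounded_borel) \<and> disjoint_family_on B {..<n} \<longrightarrow>
        prob_space.indep_vars P (\<lambda>_. borel) (\<lambda>i. \<Lambda> (B i)) {..<n}) \<and>
     (\<forall>B :: nat \<Rightarrow> real set. range B \<subseteq> bounded_borel \<and> disjoint_family B \<and> (\<Union>i. B i) \<in> bounded_borel \<longrightarrow>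
        (AE \<omega> in P. (\<lambda>i. \<Lambda> (B i) \<omega>) sums \<Lambda> (\<Union>i. B i) \<omega>)) \<and>
     (\<forall>a b. a < b \<longrightarrow> (AE \<omega> in P. \<Lambda> {a..<b} \<omega> = L b \<omega> - L a \<omega>))"

definition simple_integrand :: "(real \<Rightarrow> real) \<Rightarrow> bool" where
  "simple_integrand f \<longleftrightarrow> simple_function borel f \<and> bounded {x. f x \<noteq> 0}"

text \<open>Uses the canonical representation \<open>f = \<Sum>c. c 1\<^bsub>{f = c}\<^esub>\<close>, \<open>c\<close> ranging over the nonzero
  values of \<open>f\<close>.\<close>

definition simple_levy_integral ::
  "(real set \<Rightarrow> 'a \<Rightarrow> real ^ 'n) \<Rightarrow> real set \<Rightarrow> (real \<Rightarrow> real) \<Rightarrow> 'a \<Rightarrow> real ^ 'n" where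
  "simple_levy_integral \<Lambda> A f \<omega> = (\<Sum>c \<in> range f - {0}. c *\<^sub>R \<Lambda> (f -` {c} \<inter> A) \<omega>)"

text \<open>\<open>has_levy_integral P \<Lambda> A f Y\<close>: \<open>f\<close> is integrable with respect to \<open>\<Lambda>\<close>, and \<open>Y\<close> is a
  version of the integral of \<open>f\<close> over the Borel set \<open>A\<close>. A relation is used because limits in
  probability are determined only up to almost sure equality.\<close>

definition has_levy_integral ::
  "'a measure \<Rightarrow> (real set \<Rightarrow> 'a \<Rightarrow> real ^ 'n) \<Rightarrow> real set \<Rightarrow> (real \<Rightarrow> real) \<Rightarrow>
   ('a \<Rightarrow> real ^ 'n) \<Rightarrow> bool" where
  "has_levy_integral P \<Lambda> A f Y \<longleftrightarrow>
     f \<in> borel_measurable borel \<and> Y \<in> borel_measurable P \<and>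
     (\<exists>F. (\<forall>n. simple_integrand (F n)) \<and>
          (AE x in lborel. (\<lambda>n. F n x) \<longlonglongrightarrow> f x) \<and>
          (\<forall>B \<in> sets borel. \<exists>Z \<in> borel_measurable P.
             tendsto_in_prob P (\<lambda>n. simple_levy_integral \<Lambda> B (F n)) Z) \<and>
          tendsto_in_prob P (\<lambda>n. simple_levy_integral \<Lambda> A (F n)) Y)"

definition has_complex_levy_integral ::
  "'a measure \<Rightarrow> (real set \<Rightarrow> 'a \<Rightarrow> real ^ 'n) \<Rightarrow> real set \<Rightarrow> (real \<Rightarrow> complex) \<Rightarrow>
   ('a \<Rightarrow> complex ^ 'n) \<Rightarrow> bool" where
  "has_complex_levy_integral P \<Lambda> A f Y \<longleftrightarrow>
     has_levy_integral P \<Lambda> A (\<lambda>x. Re (f x)) (\<lambda>\<omega>. \<chi> i. Re (Y \<omega> $ i)) \<and>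
     has_levy_integral P \<Lambda> A (\<lambda>x. Im (f x)) (\<lambda>\<omega>. \<chi> i. Im (Y \<omega> $ i))"


section \<open>Random contents\<close>

definition interval_ring :: "real set set" where
  "interval_ring = \<Inter>{R. ring_of_sets UNIV R \<and> (\<forall>a b. a < b \<longrightarrow> {a..<b} \<in> R)}"

definition independently_scattered ::
  "'a measure \<Rightarrow> (real set \<Rightarrow> 'a \<Rightarrow> 'b::topological_space) \<Rightarrow> bool" where
  "independently_scattered P M \<longleftrightarrow>
     (\<forall>(n::nat) A. (\<forall>i<n. A i \<in> interval_ring) \<and> disjoint_family_on A {..<n} \<longrightarrow>
        prob_space.indep_vars P (\<lambda>_. borel) (\<lambda>i. M (A i)) {..<n})"

definition stationarily_scattered ::
  "'a measure \<Rightarrow> (real set \<Rightarrow> 'a \<Rightarrow> 'b::topological_space) \<Rightarrow> bool" where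
  "stationarily_scattered P M \<longleftrightarrow>
     (\<forall>\<tau> (n::nat) A. (\<forall>i<n. A i \<in> interval_ring) \<longrightarrow>
        distr P (\<Pi>\<^sub>M i\<in>{..<n}. borel) (\<lambda>\<omega>. \<lambda>i\<in>{..<n}. M (A i) \<omega>) =
        distr P (\<Pi>\<^sub>M i\<in>{..<n}. borel) (\<lambda>\<omega>. \<lambda>i\<in>{..<n}. M ((\<lambda>x. x + \<tau>) ` A i) \<omega>))"

definition indicator_fourier :: "real set \<Rightarrow> real \<Rightarrow> complex" where
  "indicator_fourier A \<mu> =
     of_real (1 / sqrt (2 * pi)) * (CLINT x:A|lborel. exp (- \<i> * of_real \<mu> * of_real x))"

text \<open>Each \<open>M A\<close> may be any version of the integral that defines it.\<close>

definition levy_fourier_content ::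
  "'a measure \<Rightarrow> (real \<Rightarrow> 'a \<Rightarrow> real ^ 'n) \<Rightarrow> (real set \<Rightarrow> 'a \<Rightarrow> complex ^ 'n) \<Rightarrow> bool" where
  "levy_fourier_content P L M \<longleftrightarrow>
     (\<exists>\<Lambda>. levy_random_measure P L \<Lambda> \<and>
        (\<forall>A \<in> interval_ring. \<exists>Y.
           has_complex_levy_integral P \<Lambda> UNIV (indicator_fourier A) Y \<and>
           M A = (\<lambda>\<omega>. (1 / sqrt (2 * pi)) *\<^sub>R Y \<omega>)))"

end

theory Submission
  imports Defs
begin

text \<open>
  Fix a coordinate \<open>i\<close> and write \<open>s r = - Re \<psi>\<^sub>L(r e\<^sub>i) = v r\<^sup>2 + \<integral>(1 - cos (r x\<^sub>i)) \<nu>(dx)\<close> with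
  \<open>v \<ge> 0\<close>, so that the characteristic function of \<open>\<integral> f dL\<^sub>i\<close> has modulus
  \<open>exp (- \<integral> s (r f(t)) dt)\<close>. Since
  \<open>s (a + b) + s (a - b) - 2 s a - 2 s b = - 2 \<integral>(1 - cos (a x\<^sub>i)) (1 - cos (b x\<^sub>i)) \<nu>(dx)\<close>,
  independence of the integrals of two functions \<open>f, g\<close> forces
  \<open>(1 - cos (r f(t) x\<^sub>i)) (1 - cos (r g(t) x\<^sub>i)) = 0\<close> for almost all \<open>t\<close> and \<open>x\<close>. The Fourier
  transforms of the indicators of \<open>[0,1)\<close> and \<open>[1,2)\<close> are small and nonzero at suitable large
  \<open>t\<close>, whence \<open>x\<^sub>i = 0\<close> for \<open>\<nu>\<close>-almost all \<open>x\<close>, for every \<open>i\<close>. Thus \<open>\<nu> = 0\<close>, which regular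
  variation excludes. For stationarity, the transform of the indicator of \<open>[-1,1)\<close> is real, so
  \<open>Im (M [-1,1))\<close> vanishes almost surely, whereas \<open>Im (M [0,2))\<close> does not, by the same argument.

  At the level of the approximating simple functions every limit needed is a lower bound obtained
  from Fatou's lemma. The one exception is that the integral of \<open>0\<close> is \<open>0\<close>, a consequence of
  the convergence of the approximating integrals over all Borel sets.
\<close>

section \<open>Characteristic functions and Fatou arguments\<close>

text \<open>Evaluated at 1 only: frequencies enter as factors inside \<open>X\<close>, so that
  \<open>p * X + q * Y\<close> yields the joint characteristic function of a pair without joint
  laws.\<close>

definition cf :: "'a measure \<Rightarrow> ('a \<Rightarrow> real) \<Rightarrow> complex" where
  "cf P X = (CLINT \<omega>|P. iexp (X \<omega>))"

context prob_space
begin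

lemma cf_scale_eq_char:
  assumes [measurable]: "X \<in> borel_measurable M"
  shows "cf M (\<lambda>\<omega>. r * X \<omega>) = char (distr M borel X) r"
  unfolding cf_def char_def by (subst integral_distr) auto

lemma cf_eq_char:
  assumes "X \<in> borel_measurable M"
  shows "cf M X = char (distr M borel X) 1"
  using cf_scale_eq_char[OF assms, of 1] by simp

lemma norm_cf_le_1: "norm (cf M X) \<le> 1"
proof (cases "integrable M (\<lambda>\<omega>. iexp (X \<omega>))")
  case True
  have "norm (cf M X) \<le> (\<integral>\<omega>. norm (iexp (X \<omega>)) \<partial>M)"
    unfolding cf_def by (rule integral_norm_bound)
  also have "\<dots> = 1"
    by (simp add: prob_space)
  finally show ?thesis .
next
  case False
  then show ?thesis
    by (simp add: cf_def not_integrable_integral_eq)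
qed

lemma cf_cong_AE:
  assumes "AE \<omega> in M. X \<omega> = Y \<omega>"
    and [measurable]: "X \<in> borel_measurable M" "Y \<in> borel_measurable M"
  shows "cf M X = cf M Y"
  unfolding cf_def by (rule integral_cong_AE) (use assms(1) in auto)

lemma cf_zero [simp]: "cf M (\<lambda>\<omega>. 0) = 1"
  by (simp add: cf_def prob_space)

lemma cf_uminus: "cf M (\<lambda>\<omega>. - X \<omega>) = cnj (cf M X)"
proof -
  have "iexp (- X \<omega>) = cnj (iexp (X \<omega>))" for \<omega>
    by (simp add: exp_cnj)
  then show ?thesis
    unfolding cf_def by (simp only: Bochner_Integration.integral_cnj)
qed

lemma cf_sum:
  assumes "indep_vars (\<lambda>_. borel) X I"
  shows "cf M (\<lambda>\<omega>. \<Sum>i\<in>I. X i \<omega>) = (\<Prod>i\<in>I. cf M (X i))"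
proof -
  have m: "X i \<in> borel_measurable M" if "i \<in> I" for i
    using assms that by (auto simp: indep_vars_def2)
  have "cf M (\<lambda>\<omega>. \<Sum>i\<in>I. X i \<omega>) = char (distr M borel (\<lambda>\<omega>. \<Sum>i\<in>I. X i \<omega>)) 1"
    by (intro cf_eq_char borel_measurable_sum m)
  also have "\<dots> = (\<Prod>i\<in>I. cf M (X i))"
    unfolding char_distr_sum[OF assms] by (intro prod.cong refl cf_eq_char[symmetric] m)
  finally show ?thesis .
qed

lemma tendsto_cf_AE:
  assumes "AE \<omega> in M. (\<lambda>n. X n \<omega>) \<longlonglongrightarrow> Y \<omega>"
    and [measurable]: "\<And>n. X n \<in> borel_measurable M" "Y \<in> borel_measurable M"
  shows "(\<lambda>n. cf M (X n)) \<longlonglongrightarrow> cf M Y"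
  unfolding cf_def
proof (rule integral_dominated_convergence[where w="\<lambda>_. 1"])
  show "AE \<omega> in M. (\<lambda>n. iexp (X n \<omega>)) \<longlonglongrightarrow> iexp (Y \<omega>)"
    using assms(1) by eventually_elim (intro tendsto_intros)
qed auto

end

lemma norm_iexp_diff_le: "cmod (iexp a - iexp b) \<le> \<bar>a - b\<bar>"
proof -
  have "iexp a - iexp b = iexp b * (iexp (a - b) - 1)"
    by (simp add: algebra_simps flip: exp_add)
  then have "cmod (iexp a - iexp b) = cmod (iexp (a - b) - 1)"
    by (simp add: norm_mult)
  also have "\<dots> \<le> \<bar>a - b\<bar>"
    using iexp_approx1[of "a - b" 0] by simp
  finally show ?thesis .
qed

text \<open>Off two events of small probability both approximations are within \<open>d\<close>, and
  the Lipschitz bound on \<open>iexp\<close> makes the integrands differ by at most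
  \<open>e / 2\<close>; on the events they differ by at most 2. Two sequences are treated at once
  because independence is tested on joint characteristic functions.\<close>

lemma (in prob_space) tendsto_cf_in_prob:
  fixes X X' :: "nat \<Rightarrow> 'a \<Rightarrow> real"
  assumes X: "tendsto_in_prob M X Y" and X': "tendsto_in_prob M X' Y'"
    and [measurable]: "\<And>n. X n \<in> borel_measurable M" "Y \<in> borel_measurable M"
      "\<And>n. X' n \<in> borel_measurable M" "Y' \<in> borel_measurable M"
  shows "(\<lambda>n. cf M (\<lambda>\<omega>. p * X n \<omega> + q * X' n \<omega>)) \<longlonglongrightarrow> cf M (\<lambda>\<omega>. p * Y \<omega> + q * Y' \<omega>)"
proof (rule tendstoI)
  fix e :: real assume "e > 0"
  \<comment> \<open>The summand 1 keeps the denominator positive for \<open>p = q = 0\<close> and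
    makes the second bound strict.\<close>
  define d where "d = e / (2 * (\<bar>p\<bar> + \<bar>q\<bar> + 1))"
  have d: "d > 0" "(\<bar>p\<bar> + \<bar>q\<bar>) * d < e / 2"
    using \<open>e > 0\<close> by (auto simp: d_def field_simps add_pos_nonneg)
  define B where "B n = {\<omega> \<in> space M. dist (X n \<omega>) (Y \<omega>) > d}" for n
  define B' where "B' n = {\<omega> \<in> space M. dist (X' n \<omega>) (Y' \<omega>) > d}" for n
  have [measurable]: "B n \<in> sets M" "B' n \<in> sets M" for n
    unfolding B_def B'_def by measurable
  have "(\<lambda>n. 2 * measure M (B n) + 2 * measure M (B' n)) \<longlonglongrightarrow> 2 * 0 + 2 * 0"
    using X X' d(1) unfolding tendsto_in_prob_def B_def B'_def by (intro tendsto_intros) auto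
  then have "eventually (\<lambda>n. 2 * measure M (B n) + 2 * measure M (B' n) < e / 2) sequentially"
    using \<open>e > 0\<close> by (intro order_tendstoD) auto
  then show "\<forall>\<^sub>F n in sequentially. dist (cf M (\<lambda>\<omega>. p * X n \<omega> + q * X' n \<omega>)) (cf M (\<lambda>\<omega>. p * Y \<omega> + q * Y' \<omega>)) < e"
  proof eventually_elim
    case (elim n)
    let ?a = "\<lambda>\<omega>. p * X n \<omega> + q * X' n \<omega>" and ?b = "\<lambda>\<omega>. p * Y \<omega> + q * Y' \<omega>"
    have j: "integrable M (indicat_real (B n))" "integrable M (indicat_real (B' n))"
      by (auto simp: integrable_indicator_iff emeasure_eq_measure)
    have i: "integrable M (\<lambda>\<omega>. iexp (?a \<omega>))" "integrable M (\<lambda>\<omega>. iexp (?b \<omega>))"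
      by (rule integrable_const_bound[where B=1]; simp)+
    have "dist (cf M ?a) (cf M ?b) = cmod (CLINT \<omega>|M. iexp (?a \<omega>) - iexp (?b \<omega>))"
      using i by (simp add: cf_def dist_norm)
    also have "\<dots> \<le> (\<integral>\<omega>. cmod (iexp (?a \<omega>) - iexp (?b \<omega>)) \<partial>M)"
      by (rule integral_norm_bound)
    also have "\<dots> \<le> (\<integral>\<omega>. e / 2 + 2 * indicator (B n) \<omega> + 2 * indicator (B' n) \<omega> \<partial>M)"
    proof (rule integral_mono)
      show "integrable M (\<lambda>\<omega>. cmod (iexp (?a \<omega>) - iexp (?b \<omega>)))"
        using i by auto
      show "integrable M (\<lambda>\<omega>. e / 2 + 2 * indicator (B n) \<omega> + 2 * indicator (B' n) \<omega> :: real)"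
        using j by (intro Bochner_Integration.integrable_add integrable_mult_right) auto
    next
      fix \<omega> assume w: "\<omega> \<in> space M"
      have two: "cmod (iexp (?a \<omega>) - iexp (?b \<omega>)) \<le> 2"
        using norm_triangle_ineq4[of "iexp (?a \<omega>)" "iexp (?b \<omega>)"] by simp
      show "cmod (iexp (?a \<omega>) - iexp (?b \<omega>)) \<le> e / 2 + 2 * indicator (B n) \<omega> + 2 * indicator (B' n) \<omega>"
      proof (cases "\<omega> \<in> B n \<or> \<omega> \<in> B' n")
        case True
        then show ?thesis
          using two \<open>e > 0\<close> by (auto simp: indicator_def)
      next
        case False
        then have "\<bar>X n \<omega> - Y \<omega>\<bar> \<le> d" "\<bar>X' n \<omega> - Y' \<omega>\<bar> \<le> d"
          using w by (auto simp: B_def B'_def dist_real_def)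
        then have "\<bar>p\<bar> * \<bar>X n \<omega> - Y \<omega>\<bar> + \<bar>q\<bar> * \<bar>X' n \<omega> - Y' \<omega>\<bar> \<le> \<bar>p\<bar> * d + \<bar>q\<bar> * d"
          by (intro add_mono mult_left_mono) auto
        moreover have "?a \<omega> - ?b \<omega> = p * (X n \<omega> - Y \<omega>) + q * (X' n \<omega> - Y' \<omega>)"
          by (simp add: algebra_simps)
        then have "\<bar>?a \<omega> - ?b \<omega>\<bar> \<le> \<bar>p\<bar> * \<bar>X n \<omega> - Y \<omega>\<bar> + \<bar>q\<bar> * \<bar>X' n \<omega> - Y' \<omega>\<bar>"
          by (metis abs_mult abs_triangle_ineq)
        ultimately have "cmod (iexp (?a \<omega>) - iexp (?b \<omega>)) \<le> e / 2"
          using norm_iexp_diff_le[of "?a \<omega>" "?b \<omega>"] d(2) by (simp add: distrib_right)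
        then show ?thesis
          by (simp add: add_increasing2)
      qed
    qed
    also have "\<dots> = e / 2 + 2 * measure M (B n) + 2 * measure M (B' n)"
      using j by (simp add: prob_space)
    also have "\<dots> < e"
      using elim by simp
    finally show ?case .
  qed
qed

section \<open>Fatou's lemma for integrals tending to zero\<close>

lemma nn_integral_zero_liminf:
  fixes K :: "nat \<Rightarrow> 'b \<Rightarrow> real"
  assumes "\<And>n. integrable T (K n)" "\<And>n t. K n t \<ge> 0"
    and "(\<lambda>n. LINT t|T. K n t) \<longlonglongrightarrow> 0"
  shows "AE t in T. liminf (\<lambda>n. ennreal (K n t)) = 0"
proof -
  have [measurable]: "K n \<in> borel_measurable T" for n
    using assms(1) by auto
  have "(\<integral>\<^sup>+t. liminf (\<lambda>n. ennreal (K n t)) \<partial>T) \<le> liminf (\<lambda>n. \<integral>\<^sup>+t. ennreal (K n t) \<partial>T)"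
    by (rule nn_integral_liminf) auto
  also have "(\<lambda>n. \<integral>\<^sup>+t. ennreal (K n t) \<partial>T) = (\<lambda>n. ennreal (LINT t|T. K n t))"
    using assms by (intro ext nn_integral_eq_integral) auto
  also have "liminf \<dots> = 0"
    using assms(3) by (intro lim_imp_Liminf) (auto intro: tendsto_ennrealI simp flip: ennreal_0)
  finally have "(\<integral>\<^sup>+t. liminf (\<lambda>n. ennreal (K n t)) \<partial>T) = 0"
    by simp
  then show ?thesis
    by (subst (asm) nn_integral_0_iff_AE) auto
qed

text \<open>For a fixed outer variable only the lower limit of the integrals over \<nu> is known to
  vanish. Fatou's lemma asks for no more: as \<open>H n\<close> tends to \<open>G\<close>
  everywhere, the integral of \<open>G\<close> is at most that lower limit.\<close>

lemma AE_zero_of_liminf_integral_zero: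
  fixes H :: "nat \<Rightarrow> 'c \<Rightarrow> real"
  assumes lim: "liminf (\<lambda>n. ennreal (LINT x|\<nu>. H n x)) = 0" "\<forall>x. (\<lambda>n. H n x) \<longlonglongrightarrow> G x"
    and int: "\<And>n. integrable \<nu> (H n)" and nn: "\<And>n x. H n x \<ge> 0"
  shows "AE x in \<nu>. G x = 0"
proof -
  have m[measurable]: "H n \<in> borel_measurable \<nu>" for n
  using int by auto
  have [measurable]: "G \<in> borel_measurable \<nu>"
  proof (rule borel_measurable_LIMSEQ_real)
    show "(\<lambda>n. H n x) \<longlonglongrightarrow> G x" for x using lim(2) by blast
  qed (rule m)
  have "(\<integral>\<^sup>+x. ennreal (G x) \<partial>\<nu>) = (\<integral>\<^sup>+x. liminf (\<lambda>n. ennreal (H n x)) \<partial>\<nu>)"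
  proof (rule nn_integral_cong)
    fix x
    have "(\<lambda>n. ennreal (H n x)) \<longlonglongrightarrow> ennreal (G x)"
      by (intro tendsto_ennrealI lim(2)[rule_format])
    then show "ennreal (G x) = liminf (\<lambda>n. ennreal (H n x))"
      by (intro lim_imp_Liminf[symmetric]) auto
  qed
  also have "\<dots> \<le> liminf (\<lambda>n. \<integral>\<^sup>+x. ennreal (H n x) \<partial>\<nu>)"
    by (rule nn_integral_liminf) auto
  also have "(\<lambda>n. \<integral>\<^sup>+x. ennreal (H n x) \<partial>\<nu>) = (\<lambda>n. ennreal (LINT x|\<nu>. H n x))"
    using int nn by (simp add: nn_integral_eq_integral)
  finally have "(\<integral>\<^sup>+x. ennreal (G x) \<partial>\<nu>) = 0"
    using lim(1) by simp
  then have "AE x in \<nu>. ennreal (G x) = 0"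
    by (subst (asm) nn_integral_0_iff_AE) simp_all
  moreover have "G x \<ge> 0" for x
    by (rule LIMSEQ_le_const[of "\<lambda>n. H n x"]) (use lim(2) nn in auto)
  ultimately show ?thesis
    by (auto simp: ennreal_eq_0_iff intro: antisym elim: eventually_mono)
qed
text \<open>Fatou's lemma is applied in each variable separately, so \<open>\<nu>\<close> need not be \<open>\<sigma>\<close>-finite.\<close>

lemma AE_AE_zero_of_integral_tendsto_zero:
  fixes H :: "nat \<Rightarrow> 'b \<Rightarrow> 'c \<Rightarrow> real"
  assumes "\<And>n. integrable T (\<lambda>t. LINT x|\<nu>. H n t x)"
    and int: "\<And>n t. integrable \<nu> (H n t)" and nn: "\<And>n t x. H n t x \<ge> 0"
    and lim: "(\<lambda>n. LINT t|T. LINT x|\<nu>. H n t x) \<longlonglongrightarrow> 0"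
    and conv: "AE t in T. \<forall>x. (\<lambda>n. H n t x) \<longlonglongrightarrow> G t x"
  shows "AE t in T. AE x in \<nu>. G t x = 0"
proof -
  have nn': "(LINT x|\<nu>. H n t x) \<ge> 0" for n t
    by (intro Bochner_Integration.integral_nonneg nn)
  show ?thesis
    using nn_integral_zero_liminf[OF assms(1) nn' lim] conv
  proof eventually_elim
    case (elim t)
    show ?case
      by (rule AE_zero_of_liminf_integral_zero[OF elim int nn])
  qed
qed

section \<open>Integrals of simple functions\<close>

text \<open>Models one coordinate of the random measure of the process, so that all integrals are
  real valued. The exponent is prescribed on intervals and extended to bounded Borel sets in
  \<open>cf_N\<close>.\<close>

locale levy_basis = prob_space P for P :: "'a measure" +
  fixes N :: "real set \<Rightarrow> 'a \<Rightarrow> real" and \<psi> :: "real \<Rightarrow> complex"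
  assumes N_measurable [measurable]: "\<And>B. B \<in> bounded_borel \<Longrightarrow> N B \<in> borel_measurable P"
    and N_indep: "\<And>(n::nat) B. (\<And>i. i < n \<Longrightarrow> B i \<in> bounded_borel) \<Longrightarrow>
      disjoint_family_on B {..<n} \<Longrightarrow> indep_vars (\<lambda>_. borel) (\<lambda>i. N (B i)) {..<n}"
    and N_sums: "\<And>B :: nat \<Rightarrow> real set. range B \<subseteq> bounded_borel \<Longrightarrow> disjoint_family B \<Longrightarrow>
      (\<Union>i. B i) \<in> bounded_borel \<Longrightarrow> AE \<omega> in P. (\<lambda>i. N (B i) \<omega>) sums N (\<Union>i. B i) \<omega>"
    and cf_N_interval: "\<And>a b r. a < b \<Longrightarrow>
      cf P (\<lambda>\<omega>. r * N {a..<b} \<omega>) = exp (of_real (b - a) * \<psi> r)"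
begin

text \<open>The rate, per unit of Lebesgue measure, at which the modulus of the characteristic
  function of \<open>N\<close> decays at frequency \<open>r\<close>.\<close>

definition damping :: "real \<Rightarrow> real" where
  "damping r = - Re (\<psi> r)"

definition integ :: "real set \<Rightarrow> (real \<Rightarrow> real) \<Rightarrow> 'a \<Rightarrow> real" where
  "integ B F \<omega> = (\<Sum>c \<in> range F - {0}. c * N (F -` {c} \<inter> B) \<omega>)"

lemma norm_cf_N_unit: "cmod (cf P (\<lambda>\<omega>. r * N {0..<1} \<omega>)) = exp (- damping r)"
  by (simp add: cf_N_interval damping_def)

lemma unit_in_bounded_borel [simp]: "{0..<1} \<in> bounded_borel"
  by (auto simp: bounded_borel_def)

lemma damping_nonneg: "damping r \<ge> 0"
  using norm_cf_le_1[of "\<lambda>\<omega>. r * N {0..<1} \<omega>"] unfolding norm_cf_N_unit by simp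

lemma damping_zero [simp]: "damping 0 = 0"
  using norm_cf_N_unit[of 0] by simp

text \<open>Up to sign, \<open>damping\<close> is the logarithm of the modulus of a characteristic
  function, which is continuous and equals 1 at 0.\<close>

lemma tendsto_damping_zero: "(damping \<longlongrightarrow> 0) (at 0)"
proof -
  interpret D: real_distribution "distr P borel (N {0..<1})"
    by (intro real_distribution_distr) measurable
  have eq: "damping r = - ln (cmod (char (distr P borel (N {0..<1})) r))" for r
    using norm_cf_N_unit[of r] by (subst cf_scale_eq_char[symmetric]) auto
  have "isCont (\<lambda>r. - ln (cmod (char (distr P borel (N {0..<1})) r))) 0"
    using D.char_zero by (intro continuous_intros D.isCont_char) auto
  then have "isCont damping 0"
    by (simp flip: eq)
  then show ?thesis
    by (simp add: isCont_def)
qed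

section \<open>Finite additivity and products of characteristic functions\<close>

lemma empty_in_bounded_borel [simp]: "{} \<in> bounded_borel"
  by (auto simp: bounded_borel_def)

text \<open>Countable additivity is applied to a sequence of empty sets: a constant series converges
  only if its term is 0.\<close>

lemma N_empty: "AE \<omega> in P. N {} \<omega> = 0"
proof -
  have "AE \<omega> in P. (\<lambda>i::nat. N {} \<omega>) sums N (\<Union>i::nat. {}) \<omega>"
    by (rule N_sums) (auto simp: disjoint_family_on_def)
  then show ?thesis
    by eventually_elim (auto dest: sums_summable simp: summable_const_iff)
qed

lemma N_lessThan_Union:
  fixes B :: "nat \<Rightarrow> real set"
  assumes B: "\<And>i. i < n \<Longrightarrow> B i \<in> bounded_borel" and disj: "disjoint_family_on B {..<n}"
  shows "AE \<omega> in P. N (\<Union>i<n. B i) \<omega> = (\<Sum>i<n. N (B i) \<omega>)"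
proof -
  \<comment> \<open>Padding by empty sets makes countable additivity applicable;
    \<open>N_empty\<close> removes the tail.\<close>
  define C where "C i = (if i < n then B i else {})" for i
  have C: "C i \<in> bounded_borel" for i
    using B by (auto simp: C_def)
  have UC: "(\<Union>i. C i) = (\<Union>i<n. B i)"
    by (auto simp: C_def split: if_splits)
  have "(\<Union>i<n. B i) \<in> bounded_borel"
    using B by (auto simp: bounded_borel_def)
  then have "AE \<omega> in P. (\<lambda>i. N (C i) \<omega>) sums N (\<Union>i. C i) \<omega>"
  proof (intro N_sums)
    show "disjoint_family C"
      using disj by (auto simp: disjoint_family_on_def C_def)
  qed (use C in \<open>auto simp: UC\<close>)
  then show ?thesis
    using N_empty
  proof eventually_elim
    case (elim \<omega>)
    have "(\<lambda>i. N (C i) \<omega>) sums (\<Sum>i<n. N (C i) \<omega>)"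
      using elim(2) by (intro sums_finite) (auto simp: C_def)
    then show ?case
      using elim(1) unfolding UC by (auto dest: sums_unique2 simp: C_def)
  qed
qed

lemma N_finite_Union:
  assumes "finite I" and B: "\<And>i. i \<in> I \<Longrightarrow> B i \<in> bounded_borel"
    and disj: "disjoint_family_on B I"
  shows "AE \<omega> in P. N (\<Union>i\<in>I. B i) \<omega> = (\<Sum>i\<in>I. N (B i) \<omega>)"
proof -
  obtain h where h: "bij_betw h {..<card I} I"
    using ex_bij_betw_nat_finite[OF \<open>finite I\<close>] by (auto simp: lessThan_atLeast0)
  have hI: "h i \<in> I" if "i < card I" for i
    using h that by (auto simp: bij_betw_def)
  have "disjoint_family_on (\<lambda>i. B (h i)) {..<card I}"
    using disj h unfolding disjoint_family_on_def bij_betw_def inj_on_def by blast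
  then have "AE \<omega> in P. N (\<Union>i<card I. B (h i)) \<omega> = (\<Sum>i<card I. N (B (h i)) \<omega>)"
    by (intro N_lessThan_Union) (auto intro: B hI)
  moreover have "(\<Union>i<card I. B (h i)) = (\<Union>i\<in>I. B i)"
    using h by (metis bij_betw_def image_image)
  moreover have "(\<Sum>i<card I. N (B (h i)) \<omega>) = (\<Sum>i\<in>I. N (B i) \<omega>)" for \<omega>
    using h by (rule sum.reindex_bij_betw)
  ultimately show ?thesis
    by simp
qed

text \<open>Independence is given for initial segments of the naturals; an enumeration of
  \<open>I\<close> carries it over to index sets such as \<open>bool\<close> or pairs of
  values.\<close>

lemma cf_sum_N:
  assumes "finite I" and B: "\<And>i. i \<in> I \<Longrightarrow> B i \<in> bounded_borel"
    and disj: "disjoint_family_on B I"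
  shows "cf P (\<lambda>\<omega>. \<Sum>i\<in>I. a i * N (B i) \<omega>) = (\<Prod>i\<in>I. cf P (\<lambda>\<omega>. a i * N (B i) \<omega>))"
proof -
  obtain h where h: "bij_betw h {..<card I} I"
    using ex_bij_betw_nat_finite[OF \<open>finite I\<close>] by (auto simp: lessThan_atLeast0)
  have hI: "h i \<in> I" if "i < card I" for i
    using h that by (auto simp: bij_betw_def)
  have "disjoint_family_on (\<lambda>i. B (h i)) {..<card I}"
    using disj h unfolding disjoint_family_on_def bij_betw_def inj_on_def by blast
  then have "indep_vars (\<lambda>_. borel) (\<lambda>i. N (B (h i))) {..<card I}"
    by (intro N_indep) (auto intro: B hI)
  then have "indep_vars (\<lambda>_. borel) (\<lambda>i \<omega>. a (h i) * N (B (h i)) \<omega>) {..<card I}"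
    by (rule indep_vars_compose2) auto
  from cf_sum[OF this]
  have "cf P (\<lambda>\<omega>. \<Sum>i<card I. a (h i) * N (B (h i)) \<omega>) = (\<Prod>i<card I. cf P (\<lambda>\<omega>. a (h i) * N (B (h i)) \<omega>))" .
  also have "(\<lambda>\<omega>. \<Sum>i<card I. a (h i) * N (B (h i)) \<omega>) = (\<lambda>\<omega>. \<Sum>i\<in>I. a i * N (B i) \<omega>)"
    using sum.reindex_bij_betw[OF h, of "\<lambda>i. a i * N (B i) _"] by auto
  also have "(\<Prod>i<card I. cf P (\<lambda>\<omega>. a (h i) * N (B (h i)) \<omega>)) = (\<Prod>i\<in>I. cf P (\<lambda>\<omega>. a i * N (B i) \<omega>))"
    using h by (rule prod.reindex_bij_betw)
  finally show ?thesis .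
qed

section \<open>From intervals to bounded Borel sets\<close>

lemma cf_N_atLeastLessThan:
  "cf P (\<lambda>\<omega>. r * N {a..<b} \<omega>) = exp (of_real (measure lborel {a..<b}) * \<psi> r)"
proof (cases "a < b")
  case True
  then show ?thesis
    by (simp add: cf_N_interval)
next
  \<comment> \<open>Empty intervals must be covered, since they arise as intersections with the
    window in the next lemma.\<close>
  case False
  have "cf P (\<lambda>\<omega>. r * N {} \<omega>) = cf P (\<lambda>\<omega>. 0)"
    using N_empty by (intro cf_cong_AE) auto
  then show ?thesis
    using False by simp
qed

text \<open>A Dynkin argument: half-open intervals are an intersection-stable generator, and the
  identity passes to complements and countable disjoint unions by independence and additivity. The
  fixed window keeps complements inside the domain of \<open>N\<close>.\<close>

lemma cf_N_Int_interval:
  assumes "B \<in> sets borel"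
  shows "cf P (\<lambda>\<omega>. r * N (B \<inter> {-m..<m}) \<omega>) = exp (of_real (measure lborel (B \<inter> {-m..<m})) * \<psi> r)"
proof -
  let ?G = "range (\<lambda>(a, b). {a..<b::real})" and ?J = "{-m..<m}"
  have sets: "sigma_sets UNIV ?G = sets borel"
    by (subst borel_eq_atLeastLessThan) (simp add: sets_measure_of)
  have bb: "C \<inter> ?J \<in> bounded_borel" if "C \<in> sets borel" for C
    using that by (auto simp: bounded_borel_def intro: bounded_subset[OF bounded_Ico[of "-m" m]])
  have fin: "emeasure lborel (C \<inter> ?J) \<noteq> \<infinity>" for C
    using emeasure_bounded_finite[of "C \<inter> ?J"] bounded_subset[OF bounded_Ico[of "-m" m]] by auto
  have Gstable: "Int_stable ?G"
    by (auto simp: Int_stable_def Int_atLeastLessThan) 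
  have Gpow: "?G \<subseteq> Pow UNIV"
    by auto
  have "B \<in> sigma_sets UNIV ?G"
    using assms sets by simp
  with Gstable Gpow show ?thesis
  proof (induction rule: sigma_sets_induct_disjoint)
    case (basic A)
    then obtain a b where "A = {a..<b}"
      by auto
    then have "A \<inter> ?J = {max a (-m)..<min b m}"
      by auto
    then show ?case
      by (simp only: cf_N_atLeastLessThan)
  next
    case empty
    show ?case
      using cf_N_atLeastLessThan[of r 0 0] by simp
  next
    case (compl A)
    then have A: "A \<in> sets borel"
      using sets by auto
    define E where "E b = (if b then A \<inter> ?J else (UNIV - A) \<inter> ?J)" for b
    have E: "E b \<in> bounded_borel" for b
      using A by (auto simp: E_def intro!: bb)
    have dE: "disjoint_family E"
      by (auto simp: disjoint_family_on_def E_def)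
    have UE: "(\<Union>b. E b) = ?J"
      by (auto simp: E_def UNIV_bool)
    have "AE \<omega> in P. N ?J \<omega> = (\<Sum>b\<in>UNIV. N (E b) \<omega>)"
      using N_finite_Union[of UNIV E] E dE unfolding UE by auto
    then have "cf P (\<lambda>\<omega>. r * N ?J \<omega>) = cf P (\<lambda>\<omega>. \<Sum>b\<in>UNIV. r * N (E b) \<omega>)"
      using E bb[of UNIV] by (intro cf_cong_AE) (auto simp: sum_distrib_left)
    also have "\<dots> = (\<Prod>b\<in>UNIV. cf P (\<lambda>\<omega>. r * N (E b) \<omega>))"
      using E dE by (intro cf_sum_N) auto
    also have "\<dots> = cf P (\<lambda>\<omega>. r * N (A \<inter> ?J) \<omega>) * cf P (\<lambda>\<omega>. r * N ((UNIV - A) \<inter> ?J) \<omega>)"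
      by (simp add: UNIV_bool E_def)
    finally have 1: "exp (of_real (measure lborel ?J) * \<psi> r) =
        exp (of_real (measure lborel (A \<inter> ?J)) * \<psi> r) * cf P (\<lambda>\<omega>. r * N ((UNIV - A) \<inter> ?J) \<omega>)"
      unfolding compl.IH cf_N_atLeastLessThan .
    have "measure lborel ((A \<inter> ?J) \<union> ((UNIV - A) \<inter> ?J)) =
        measure lborel (A \<inter> ?J) + measure lborel ((UNIV - A) \<inter> ?J)"
      using A fin by (intro measure_Union) auto
    also have "(A \<inter> ?J) \<union> ((UNIV - A) \<inter> ?J) = ?J"
      by auto
    finally have 2: "exp (of_real (measure lborel ?J) * \<psi> r) =
        exp (of_real (measure lborel (A \<inter> ?J)) * \<psi> r) * exp (of_real (measure lborel ((UNIV - A) \<inter> ?J)) * \<psi> r)"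
      by (simp add: distrib_right exp_add)
    \<comment> \<open>The factor belonging to \<open>A\<close> is an exponential, hence nonzero, and
      cancels.\<close>
    show ?case
      using 1 unfolding 2 by simp
  next
    case (union A)
    then have A: "A i \<in> sets borel" for i
      using sets by auto
    have dA: "disjoint_family (\<lambda>i. A i \<inter> ?J)"
      using union by (auto simp: disjoint_family_on_def)
    have UA: "(\<Union>i. A i \<inter> ?J) = (\<Union>i. A i) \<inter> ?J"
      by auto
    have "AE \<omega> in P. (\<lambda>i. N (A i \<inter> ?J) \<omega>) sums N (\<Union>i. A i \<inter> ?J) \<omega>"
      by (rule N_sums) (use A dA in \<open>auto simp: UA intro!: bb\<close>)
    then have "AE \<omega> in P. (\<lambda>n. \<Sum>i<n. r * N (A i \<inter> ?J) \<omega>) \<longlonglongrightarrow> r * N ((\<Union>i. A i) \<inter> ?J) \<omega>"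
      unfolding UA sums_def
      by eventually_elim (auto intro!: tendsto_intros simp flip: sum_distrib_left)
    then have "(\<lambda>n. cf P (\<lambda>\<omega>. \<Sum>i<n. r * N (A i \<inter> ?J) \<omega>)) \<longlonglongrightarrow> cf P (\<lambda>\<omega>. r * N ((\<Union>i. A i) \<inter> ?J) \<omega>)"
      using A bb by (intro tendsto_cf_AE) auto
    moreover have "cf P (\<lambda>\<omega>. \<Sum>i<n. r * N (A i \<inter> ?J) \<omega>) =
        exp (of_real (\<Sum>i<n. measure lborel (A i \<inter> ?J)) * \<psi> r)" for n
    proof -
      have "cf P (\<lambda>\<omega>. \<Sum>i<n. r * N (A i \<inter> ?J) \<omega>) = (\<Prod>i<n. cf P (\<lambda>\<omega>. r * N (A i \<inter> ?J) \<omega>))"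
        using A bb dA by (intro cf_sum_N) (auto simp: disjoint_family_on_def)
      also have "\<dots> = exp (of_real (\<Sum>i<n. measure lborel (A i \<inter> ?J)) * \<psi> r)"
        by (simp only: union.IH) (simp add: sum_distrib_right exp_sum)
      finally show ?thesis .
    qed
    moreover have "(\<lambda>n. exp (of_real (\<Sum>i<n. measure lborel (A i \<inter> ?J)) * \<psi> r)) \<longlonglongrightarrow>
        exp (of_real (measure lborel ((\<Union>i. A i) \<inter> ?J)) * \<psi> r)"
    proof -
      have "(\<lambda>i. measure lborel (A i \<inter> ?J)) sums measure lborel (\<Union>i. A i \<inter> ?J)"
        by (rule measure_UNION) (use A dA fin in \<open>auto simp: UA\<close>)
      then show ?thesis
        unfolding UA sums_def by (intro tendsto_intros)
    qed
    ultimately show ?case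
      by (simp add: LIMSEQ_unique)
  qed
qed

lemma cf_N:
  assumes "B \<in> bounded_borel"
  shows "cf P (\<lambda>\<omega>. r * N B \<omega>) = exp (of_real (measure lborel B) * \<psi> r)"
proof -
  obtain m where m: "\<And>x. x \<in> B \<Longrightarrow> \<bar>x\<bar> \<le> m"
    using assms by (auto simp: bounded_borel_def bounded_real)
  \<comment> \<open>The margin 1 is due to the window being open on the right, while
    \<open>m\<close> itself may belong to \<open>B\<close>.\<close>
  have "B \<inter> {- (m + 1)..<m + 1} = B"
    using m by (force simp: abs_le_iff)
  then show ?thesis
    using cf_N_Int_interval[of B r "m + 1"] assms by (simp add: bounded_borel_def)
qed

lemma integ_measurable [measurable]:
  assumes "simple_integrand F" and "B \<in> sets borel"
  shows "integ B F \<in> borel_measurable P"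
proof -
  have "F -` {c} \<inter> B \<in> bounded_borel" if "c \<noteq> 0" for c
    using assms that unfolding simple_integrand_def bounded_borel_def
    by (auto dest!: borel_measurable_simple_function intro: measurable_sets_borel elim!: bounded_subset)
  then show ?thesis
    unfolding integ_def by (intro borel_measurable_sum borel_measurable_times) auto
qed

section \<open>Two simple integrands on a common refinement\<close>

context
  fixes F G :: "real \<Rightarrow> real" and B :: "real set"
  assumes F: "simple_integrand F" and G: "simple_integrand G" and B: "B \<in> sets borel"
begin

text \<open>The cells of the common refinement of the level sets of \<open>F\<close> and
  \<open>G\<close>: both functions are constant on each, so linear combinations of the two integrals
  become sums of independent terms.\<close>

definition "piece = (\<lambda>k. {t. F t = fst k \<and> G t = snd k} \<inter> B)"

text \<open>The pair of zeros is left out because its cell may be unbounded, hence outside the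
  domain of \<open>N\<close>.\<close>

definition "piece_idx = range F \<times> range G - {(0, 0)}"

lemma measurable_FG: "F \<in> borel_measurable borel" "G \<in> borel_measurable borel"
  using F G by (auto simp: simple_integrand_def borel_measurable_simple_function)

lemma finite_piece_idx: "finite piece_idx" "finite (range F)" "finite (range G)"
  using F G by (auto simp: simple_integrand_def simple_function_def piece_idx_def)

lemma piece_bounded_borel: "k \<noteq> (0, 0) \<Longrightarrow> piece k \<in> bounded_borel"
proof -
  assume k: "k \<noteq> (0, 0)"
  have [measurable]: "F \<in> borel_measurable borel" "G \<in> borel_measurable borel" "B \<in> sets borel"
    using measurable_FG B by auto
  have "bounded ({t. F t \<noteq> 0} \<union> {t. G t \<noteq> 0})"
    using F G by (auto simp: simple_integrand_def)
  moreover have "piece k \<subseteq> {t. F t \<noteq> 0} \<union> {t. G t \<noteq> 0}"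
    using k by (cases k) (auto simp: piece_def)
  ultimately have "bounded (piece k)"
    by (rule bounded_subset)
  moreover have "piece k \<in> sets borel"
    unfolding piece_def by measurable
  ultimately show ?thesis
    by (simp add: bounded_borel_def)
qed

lemma disjoint_piece: "disjoint_family_on piece K"
  by (auto simp: disjoint_family_on_def piece_def prod_eq_iff)

text \<open>Finite additivity cuts each nonzero level set of \<open>F\<close> along the values of
  \<open>G\<close>. The identity is almost sure because additivity of \<open>N\<close> is.\<close>

lemma AE_integ_pieces:
  "AE \<omega> in P. integ B F \<omega> = (\<Sum>k\<in>piece_idx. fst k * N (piece k) \<omega>)"
proof -
  have "AE \<omega> in P. N (F -` {c} \<inter> B) \<omega> = (\<Sum>d\<in>range G. N (piece (c, d)) \<omega>)" if "c \<noteq> 0" for c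
  proof -
    have "AE \<omega> in P. N (\<Union>d\<in>range G. piece (c, d)) \<omega> = (\<Sum>d\<in>range G. N (piece (c, d)) \<omega>)"
      using that finite_piece_idx
      by (intro N_finite_Union piece_bounded_borel) (auto simp: disjoint_family_on_def piece_def)
    moreover have "(\<Union>d\<in>range G. piece (c, d)) = F -` {c} \<inter> B"
      by (auto simp: piece_def)
    ultimately show ?thesis
      by simp
  qed
  then have "AE \<omega> in P. \<forall>c\<in>range F - {0}. N (F -` {c} \<inter> B) \<omega> = (\<Sum>d\<in>range G. N (piece (c, d)) \<omega>)"
    using finite_piece_idx by (subst AE_finite_all) auto
  then show ?thesis
  proof eventually_elim
    case (elim \<omega>)
    have "integ B F \<omega> = (\<Sum>c\<in>range F - {0}. \<Sum>d\<in>range G. c * N (piece (c, d)) \<omega>)"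
      using elim by (simp add: integ_def sum_distrib_left)
    also have "\<dots> = (\<Sum>k\<in>(range F - {0}) \<times> range G. fst k * N (piece k) \<omega>)"
      by (simp add: sum.cartesian_product case_prod_beta)
    \<comment> \<open>The pairs added here have first entry 0 and contribute nothing.\<close>
    also have "\<dots> = (\<Sum>k\<in>piece_idx. fst k * N (piece k) \<omega>)"
      using finite_piece_idx(1) by (intro sum.mono_neutral_left) (auto simp: piece_idx_def)
    finally show ?case .
  qed
qed

end

lemma AE_integ_pieces':
  assumes F: "simple_integrand F" and G: "simple_integrand G" and B: "B \<in> sets borel"
  shows "AE \<omega> in P. integ B G \<omega> = (\<Sum>k\<in>piece_idx F G. snd k * N (piece F G B k) \<omega>)"
proof -
  have "(\<Sum>k\<in>piece_idx F G. snd k * N (piece F G B k) \<omega>) = (\<Sum>k\<in>piece_idx G F. fst k * N (piece G F B k) \<omega>)" for \<omega>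
    by (rule sum.reindex_bij_witness[where i=prod.swap and j=prod.swap])
      (auto simp: piece_idx_def[OF F G B] piece_idx_def[OF G F B] piece_def[OF F G B] piece_def[OF G F B] conj_commute)
  then show ?thesis
    using AE_integ_pieces[OF G F B] by simp
qed

text \<open>On the common refinement the linear combination is a sum of independent terms, so
  characteristic functions multiply and the exponents add up to an integral. The Borel set
  \<open>B\<close> stays general because integrability with respect to \<open>N\<close> speaks of
  all Borel sets.\<close>

lemma norm_cf_integ:
  assumes F: "simple_integrand F" and G: "simple_integrand G" and B: "B \<in> sets borel"
  shows "integrable lborel (\<lambda>t. indicator B t * damping (p * F t + q * G t))" (is ?int)
    and "cmod (cf P (\<lambda>\<omega>. p * integ B F \<omega> + q * integ B G \<omega>)) =
      exp (- (LINT t|lborel. indicator B t * damping (p * F t + q * G t)))" (is ?eq)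
proof -
  let ?K = "piece_idx F G" and ?E = "piece F G B" and ?a = "\<lambda>k. p * fst k + q * snd k"
  have K: "finite ?K" and E: "\<And>k. k \<in> ?K \<Longrightarrow> ?E k \<in> bounded_borel"
    using finite_piece_idx[OF F G B] piece_bounded_borel[OF F G B] by (auto simp: piece_idx_def[OF F G B])
  have fin: "emeasure lborel (?E k) < \<infinity>" "?E k \<in> sets lborel" if "k \<in> ?K" for k
    using E[OF that] emeasure_bounded_finite[of "?E k"] by (auto simp: bounded_borel_def)
  \<comment> \<open>Where both functions vanish the left side is 0 by \<open>damping_zero\<close>,
    in agreement with the omitted pair of zeros.\<close>
  have pointwise: "indicator B t * damping (p * F t + q * G t) = (\<Sum>k\<in>?K. damping (?a k) * indicator (?E k) t)" for t
  proof (cases "t \<in> B \<and> (F t, G t) \<noteq> (0, 0)")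
    case True
    then have "(\<Sum>k\<in>?K. damping (?a k) * indicator (?E k) t) = (\<Sum>k\<in>{(F t, G t)}. damping (?a k) * indicator (?E k) t)"
      using K by (intro sum.mono_neutral_right) (auto simp: piece_idx_def[OF F G B] piece_def[OF F G B] indicator_def)
    then show ?thesis
      using True by (auto simp: piece_def[OF F G B])
  next
    case False
    then have "(\<Sum>k\<in>?K. damping (?a k) * indicator (?E k) t) = 0"
      by (intro sum.neutral) (auto simp: piece_idx_def[OF F G B] piece_def[OF F G B] indicator_def)
    then show ?thesis
      using False by (auto simp: indicator_def)
  qed
  have int: "integrable lborel (\<lambda>t. damping (?a k) * indicator (?E k) t)" if "k \<in> ?K" for k
    using fin[OF that] by (intro integrable_mult_right) (auto simp: integrable_indicator_iff)
  show ?int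
    unfolding pointwise using int by (intro Bochner_Integration.integrable_sum) auto
  have "(LINT t|lborel. indicator B t * damping (p * F t + q * G t)) = (\<Sum>k\<in>?K. damping (?a k) * measure lborel (?E k))"
    unfolding pointwise using int fin by (subst Bochner_Integration.integral_sum) auto
  moreover have "AE \<omega> in P. p * integ B F \<omega> + q * integ B G \<omega> = (\<Sum>k\<in>?K. ?a k * N (?E k) \<omega>)"
    using AE_integ_pieces[OF F G B] AE_integ_pieces'[OF F G B]
    by eventually_elim (simp add: sum_distrib_left sum.distrib distrib_right mult.assoc)
  then have "cf P (\<lambda>\<omega>. p * integ B F \<omega> + q * integ B G \<omega>) = cf P (\<lambda>\<omega>. \<Sum>k\<in>?K. ?a k * N (?E k) \<omega>)"
    using F G B E by (intro cf_cong_AE) auto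
  moreover have "\<dots> = (\<Prod>k\<in>?K. cf P (\<lambda>\<omega>. ?a k * N (?E k) \<omega>))"
    using K E disjoint_piece[OF F G B] by (intro cf_sum_N) auto
  moreover have "cmod \<dots> = (\<Prod>k\<in>?K. exp (- (damping (?a k) * measure lborel (?E k))))"
    unfolding prod_norm[symmetric] using E by (intro prod.cong) (auto simp: cf_N damping_def)
  ultimately show ?eq
    using K by (simp add: exp_sum[symmetric] sum_negf)
qed

end

section \<open>Setwise convergence and cosine products\<close>

text \<open>A gliding hump: since \<open>g n\<close> tends to \<open>0\<close> almost everywhere, some subsequence \<open>a\<close> is
  almost disjointly supported, in the sense that the pointwise minima of pairs \<open>a i, a j\<close> are
  dominated by one function \<open>r\<close> of small integral. On the set \<open>B\<close> where an \<open>a j\<close> with even \<open>j\<close>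
  dominates, the integrals of the odd terms are then small and those of the even terms are not.\<close>

lemma integral_tendsto_zero_of_convergent_on_sets:
  fixes g :: "nat \<Rightarrow> 'b \<Rightarrow> real"
  assumes int: "\<And>n. integrable T (g n)" and nn: "\<And>n t. g n t \<ge> 0"
    and ae: "AE t in T. (\<lambda>n. g n t) \<longlonglongrightarrow> 0"
    and conv: "\<And>B. B \<in> sets T \<Longrightarrow> convergent (\<lambda>n. LINT t|T. indicator B t * g n t)"
  shows "(\<lambda>n. LINT t|T. g n t) \<longlonglongrightarrow> 0"
proof -
  have [measurable]: "g n \<in> borel_measurable T" for n
    using int by auto
  have "(\<lambda>n. LINT t|T. indicator (space T) t * g n t) = (\<lambda>n. LINT t|T. g n t)"
    by (intro ext Bochner_Integration.integral_cong) (auto simp: indicator_def)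
  then obtain c where c: "(\<lambda>n. LINT t|T. g n t) \<longlonglongrightarrow> c"
    using conv[of "space T"] by (auto simp: convergent_def)
  have "c \<ge> 0"
    using c by (rule LIMSEQ_le_const) (auto intro!: Bochner_Integration.integral_nonneg nn)
  have "\<not> c > 0"
  proof
    assume "c > 0"
    \<comment> \<open>The two bounds on the limit \<open>l\<close> obtained below,
      \<open>l \<le> e\<close> and \<open>c - e \<le> l\<close>, give \<open>c \<le> 2 * e\<close>,
      which is \<open>c / 2\<close>: a contradiction.\<close>
    define e where "e = c / 4"
    have "e > 0"
      using \<open>c > 0\<close> by (simp add: e_def)
    \<comment> \<open>A sum of all earlier terms, so that one comparison with \<open>H m\<close>
      bounds the minimum with each of them.\<close>
    define H where "H m t = (\<Sum>i\<le>m. g i t)" for m t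
    have H: "integrable T (H m)" "H m t \<ge> 0" for m t
      unfolding H_def using int nn by (auto intro: sum_nonneg)
    have [measurable]: "H m \<in> borel_measurable T" for m
      using H by auto
    have le_H: "g i t \<le> H m t" if "i \<le> m" for i m t
      unfolding H_def using that nn by (intro member_le_sum) auto
    have min_int: "integrable T (\<lambda>t. min (g n t) (H m t))" for n m
      by (rule Bochner_Integration.integrable_bound[OF int[of n]]) (use nn H in \<open>auto simp: min_def\<close>)
    have "(\<lambda>n. LINT t|T. min (g n t) (H m t)) \<longlonglongrightarrow> (LINT t|T. 0)" for m
    proof (rule integral_dominated_convergence[where w="H m"])
      show "AE t in T. (\<lambda>n. min (g n t) (H m t)) \<longlonglongrightarrow> 0"
        using ae
      proof eventually_elim
        case (elim t)
        then have "(\<lambda>n. min (g n t) (H m t)) \<longlonglongrightarrow> min 0 (H m t)"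
          by (intro tendsto_intros)
        then show ?case
          using H by simp
      qed
    qed (use H nn in \<open>auto simp: min_def\<close>)
    then have small: "\<exists>n>m. (LINT t|T. min (g n t) (H m t)) \<le> d" if "d > 0" for m d
    proof -
      assume "\<And>m. (\<lambda>n. LINT t|T. min (g n t) (H m t)) \<longlonglongrightarrow> (LINT t|T. 0)"
      from this[of m] have "eventually (\<lambda>n. (LINT t|T. min (g n t) (H m t)) < d) sequentially"
        using that by (intro order_tendstoD) auto
      then have "eventually (\<lambda>n. n > m \<and> (LINT t|T. min (g n t) (H m t)) < d) sequentially"
        using eventually_gt_at_top[of m] by eventually_elim simp
      then show ?thesis
        by (auto simp: eventually_sequentially intro: less_imp_le)
    qed
    \<comment> \<open>The subsequence is chosen recursively, each term far enough out that its
      overlap with all earlier ones stays within a budget; the budgets sum to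
      \<open>e\<close>.\<close>
    have "\<exists>\<nu>::nat \<Rightarrow> nat. \<forall>k. True \<and>
        (\<nu> k < \<nu> (Suc k) \<and> (LINT t|T. min (g (\<nu> (Suc k)) t) (H (\<nu> k) t)) \<le> e * (1/2) ^ Suc k)"
    proof (rule dependent_nat_choice)
      fix m k :: nat
      show "\<exists>n. True \<and> m < n \<and> (LINT t|T. min (g n t) (H m t)) \<le> e * (1/2) ^ Suc k"
        using small[of "e * (1/2) ^ Suc k" m] \<open>e > 0\<close> by simp
    qed simp
    then obtain \<nu> where \<nu>: "\<And>k. \<nu> k < \<nu> (Suc k)"
      "\<And>k. (LINT t|T. min (g (\<nu> (Suc k)) t) (H (\<nu> k) t)) \<le> e * (1/2) ^ Suc k"
      by auto
    have mono: "strict_mono \<nu>"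
      using \<nu>(1) by (simp add: strict_mono_Suc_iff)
    define a where "a k = g (\<nu> k)" for k
    have [measurable]: "a k \<in> borel_measurable T" for k
      unfolding a_def by measurable
    have a_nn: "a k t \<ge> 0" and a_int: "integrable T (a k)" for k t
      using nn int by (auto simp: a_def)
    define r where "r t = (\<Sum>k. ennreal (min (a (Suc k) t) (H (\<nu> k) t)))" for t
    have [measurable]: "r \<in> borel_measurable T"
      unfolding r_def by measurable
    have "(\<integral>\<^sup>+t. r t \<partial>T) = (\<Sum>k. \<integral>\<^sup>+t. ennreal (min (a (Suc k) t) (H (\<nu> k) t)) \<partial>T)"
      unfolding r_def by (rule nn_integral_suminf) measurable
    also have "\<dots> \<le> (\<Sum>k. ennreal (e * (1/2) ^ Suc k))"
    proof (rule suminf_le)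
      fix k
      have "(\<integral>\<^sup>+t. ennreal (min (a (Suc k) t) (H (\<nu> k) t)) \<partial>T) = ennreal (LINT t|T. min (a (Suc k) t) (H (\<nu> k) t))"
        unfolding a_def by (intro nn_integral_eq_integral min_int) (use nn H in auto)
      then show "(\<integral>\<^sup>+t. ennreal (min (a (Suc k) t) (H (\<nu> k) t)) \<partial>T) \<le> ennreal (e * (1/2) ^ Suc k)"
        using \<nu>(2)[of k] by (simp add: a_def ennreal_leI)
    qed auto
    also have "\<dots> = ennreal e"
      using sums_mult[OF power_half_series, of e] \<open>e > 0\<close>
      by (intro suminf_ennreal_eq) auto
    finally have r_int: "(\<integral>\<^sup>+t. r t \<partial>T) \<le> ennreal e" .
    have min_le_r: "ennreal (min (a j t) (a k t)) \<le> r t" if "j < k" for j k t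
    proof -
      obtain k' where k': "k = Suc k'" "j \<le> k'"
        using \<open>j < k\<close> by (cases k) auto
      have "a j t \<le> H (\<nu> k') t"
        unfolding a_def using mono k' by (intro le_H) (simp add: strict_mono_less_eq)
      then have "ennreal (min (a j t) (a k t)) \<le> ennreal (min (a (Suc k') t) (H (\<nu> k') t))"
        by (auto simp: k' intro!: ennreal_leI)
      also have "\<dots> \<le> r t"
        unfolding r_def using sum_le_suminf[of "\<lambda>k. ennreal (min (a (Suc k) t) (H (\<nu> k) t))" "{k'}"] by simp
      finally show ?thesis .
    qed
    have le_r: "ennreal (a k t) \<le> r t" if "a k t \<le> a j t" "j \<noteq> k" for j k t
    proof -
      have "ennreal (a k t) = ennreal (min (a j t) (a k t))" "min (a j t) (a k t) = min (a k t) (a j t)"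
        using that by auto
      then show ?thesis
        using min_le_r[of j k t] min_le_r[of k j t] \<open>j \<noteq> k\<close> by (cases "j < k") auto
    qed
    define B where "B = {t \<in> space T. \<exists>j. even j \<and> (\<forall>i. odd i \<longrightarrow> a i t < a j t)}"
    have [measurable]: "B \<in> sets T"
      unfolding B_def by measurable
    have ind_int: "integrable T (\<lambda>t. indicator D t * a k t)" if "D \<in> sets T" for k D
      using integrable_mult_indicator[OF that a_int[of k]] by simp
    have small_int: "(LINT t|T. indicator D t * a k t) \<le> e"
      if D: "D \<in> sets T" "\<And>t. t \<in> D \<Longrightarrow> ennreal (a k t) \<le> r t" for D k
    proof -
      have "ennreal (LINT t|T. indicator D t * a k t) = (\<integral>\<^sup>+t. ennreal (indicator D t * a k t) \<partial>T)"
        using ind_int D a_nn by (intro nn_integral_eq_integral[symmetric]) auto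
      also have "\<dots> \<le> (\<integral>\<^sup>+t. r t \<partial>T)"
        using D by (intro nn_integral_mono) (auto simp: indicator_def)
      also have "\<dots> \<le> ennreal e"
        by (rule r_int)
      finally show ?thesis
        using \<open>e > 0\<close> by simp
    qed
    obtain l where l: "(\<lambda>n. LINT t|T. indicator B t * g n t) \<longlonglongrightarrow> l"
      using conv[of B] by (auto simp: convergent_def)
    have l_sub: "(\<lambda>k. LINT t|T. indicator B t * a (h k) t) \<longlonglongrightarrow> l" if "strict_mono h" for h
      unfolding a_def using LIMSEQ_subseq_LIMSEQ[OF l strict_mono_o[OF mono that]] by (simp add: o_def)
    have c_sub: "(\<lambda>k. LINT t|T. a (h k) t) \<longlonglongrightarrow> c" if "strict_mono h" for h
      unfolding a_def using LIMSEQ_subseq_LIMSEQ[OF c strict_mono_o[OF mono that]] by (simp add: o_def)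
    have "l \<le> e"
    proof (rule LIMSEQ_le_const2[OF l_sub])
      show "strict_mono (\<lambda>k::nat. 2 * k + 1)"
        by (auto simp: strict_mono_def)
      have "(LINT t|T. indicator B t * a (2 * k + 1) t) \<le> e" for k
      proof (rule small_int)
        fix t assume "t \<in> B"
        then obtain j where "even j" "a (2 * k + 1) t < a j t"
          unfolding B_def by (auto dest: spec[of _ "2 * k + 1"])
        then show "ennreal (a (2 * k + 1) t) \<le> r t"
          by (intro le_r[of _ _ j]) auto
      qed measurable
      then show "\<exists>N. \<forall>n\<ge>N. (LINT t|T. indicator B t * a (2 * n + 1) t) \<le> e"
        by blast
    qed
    moreover have "c - e \<le> l"
    proof (rule LIMSEQ_le)
      show "(\<lambda>k. (LINT t|T. a (2 * k) t) - e) \<longlonglongrightarrow> c - e"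
        by (intro tendsto_intros c_sub) (auto simp: strict_mono_def)
      show "(\<lambda>k. LINT t|T. indicator B t * a (2 * k) t) \<longlonglongrightarrow> l"
        by (intro l_sub) (auto simp: strict_mono_def)
      have "(LINT t|T. a (2 * k) t) - e \<le> (LINT t|T. indicator B t * a (2 * k) t)" for k
      proof -
        have "(LINT t|T. indicator (space T - B) t * a (2 * k) t) \<le> e"
        proof (rule small_int)
          fix t assume "t \<in> space T - B"
          then obtain i where "odd i" "a (2 * k) t \<le> a i t"
            unfolding B_def by (auto simp: not_less dest: spec[of _ "2 * k"])
          then show "ennreal (a (2 * k) t) \<le> r t"
            by (intro le_r[of _ _ i]) auto
        qed measurable
        moreover have "(LINT t|T. a (2 * k) t) =
            (LINT t|T. indicator B t * a (2 * k) t + indicator (space T - B) t * a (2 * k) t)"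
          by (intro Bochner_Integration.integral_cong) (auto simp: indicator_def)
        ultimately show ?thesis
          using ind_int[of B "2 * k"] ind_int[of "space T - B" "2 * k"] by simp
      qed
      then show "\<exists>N. \<forall>n\<ge>N. (LINT t|T. a (2 * n) t) - e \<le> (LINT t|T. indicator B t * a (2 * n) t)"
        by blast
    qed
    ultimately show False
      using \<open>c > 0\<close> by (simp add: e_def)
  qed
  then show ?thesis
    using c \<open>c \<ge> 0\<close> by simp
qed

section \<open>Cosine products along times tending to infinity\<close>

lemma ex_in_interval_of_AE_lborel:
  fixes a b :: real
  assumes "AE t in lborel. Q t" and "a < b"
  shows "\<exists>t\<in>{a<..<b}. Q t"
proof (rule ccontr)
  assume "\<not> ?thesis"
  then have "AE t in lborel. t \<notin> {a<..<b}"
    using assms(1) by (auto elim: eventually_mono)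
  then have "{a<..<b} \<in> null_sets lborel"
    by (subst (asm) AE_iff_null_sets[symmetric]) auto
  then show False
    using \<open>a < b\<close> by (simp add: null_sets_def)
qed

lemma cos_ne_1:
  assumes "y \<noteq> 0" and "\<bar>y\<bar> < 2 * pi"
  shows "cos y \<noteq> 1"
proof
  assume "cos y = 1"
  then obtain k :: int where k: "y = of_int k * 2 * pi"
    by (auto simp: cos_one_2pi_int)
  then have "\<bar>of_int k :: real\<bar> * (2 * pi) < 1 * (2 * pi)"
    using assms(2) by (simp add: abs_mult)
  then have "\<bar>of_int k :: real\<bar> < 1"
    by (rule mult_right_less_imp_less) simp
  then show False
    using k assms(1) by simp
qed

text \<open>A good time is picked in each of countably many intervals, so that one null set of \<nu>
  serves for all of them. Along these times \<open>f\<close> and \<open>g\<close> are nonzero and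
  tend to 0. If \<open>h x\<close> is nonzero, both cosine arguments are therefore eventually
  nonzero and below \<open>2 * pi\<close> in absolute value, where the cosine is not 1.\<close>

lemma AE_zero_of_one_minus_cos_product:
  fixes f g :: "real \<Rightarrow> real" and h :: "'b \<Rightarrow> real"
  assumes ae: "AE t in lborel. AE x in \<nu>. (1 - cos (f t * h x)) * (1 - cos (g t * h x)) = 0"
    and f: "(f \<longlongrightarrow> 0) at_top" and g: "(g \<longlongrightarrow> 0) at_top"
    and nz: "\<And>(m::nat) t. t \<in> {2 * pi * real m + pi / 2<..<2 * pi * real m + pi} \<Longrightarrow> f t \<noteq> 0 \<and> g t \<noteq> 0"
  shows "AE x in \<nu>. h x = 0"
proof -
  define Q where "Q t \<longleftrightarrow> (AE x in \<nu>. (1 - cos (f t * h x)) * (1 - cos (g t * h x)) = 0)" for t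
  have "AE t in lborel. Q t"
    unfolding Q_def by (rule ae)
  then have "\<exists>t\<in>{2 * pi * real m + pi / 2<..<2 * pi * real m + pi}. Q t" for m
    by (rule ex_in_interval_of_AE_lborel) simp
  then obtain \<tau> where \<tau>: "\<And>m. \<tau> m \<in> {2 * pi * real m + pi / 2<..<2 * pi * real m + pi}" and "\<And>m. Q (\<tau> m)"
    by metis
  then have ae_\<tau>: "AE x in \<nu>. (1 - cos (f (\<tau> m) * h x)) * (1 - cos (g (\<tau> m) * h x)) = 0" for m
    by (simp add: Q_def)
  have "filterlim \<tau> at_top sequentially"
  proof (rule filterlim_at_top_mono)
    show "filterlim (\<lambda>m. real m) at_top sequentially"
      by (rule filterlim_real_sequentially)
    have "real m \<le> \<tau> m" for m
    proof -
      have "real m * 1 \<le> real m * (2 * pi)"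
        using pi_ge_two by (intro mult_left_mono) auto
      then show ?thesis
        using \<tau>[of m] pi_gt_zero by (auto simp: mult.commute)
    qed
    then show "\<forall>\<^sub>F m in sequentially. real m \<le> \<tau> m"
      by simp
  qed
  then have lim: "(\<lambda>m. f (\<tau> m)) \<longlonglongrightarrow> 0" "(\<lambda>m. g (\<tau> m)) \<longlonglongrightarrow> 0"
    using f g by (auto intro: filterlim_compose)
  have "AE x in \<nu>. \<forall>m. (1 - cos (f (\<tau> m) * h x)) * (1 - cos (g (\<tau> m) * h x)) = 0"
    using ae_\<tau> by (simp add: AE_all_countable)
  then show ?thesis
  proof eventually_elim
    case (elim x)
    show ?case
    proof (rule ccontr)
      assume hx: "h x \<noteq> 0"
      have "(\<lambda>m. \<bar>f (\<tau> m) * h x\<bar>) \<longlonglongrightarrow> \<bar>0 * h x\<bar>" "(\<lambda>m. \<bar>g (\<tau> m) * h x\<bar>) \<longlonglongrightarrow> \<bar>0 * h x\<bar>"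
        by (intro tendsto_intros lim)+
      then have "\<forall>\<^sub>F m in sequentially. \<bar>f (\<tau> m) * h x\<bar> < 2 * pi" "\<forall>\<^sub>F m in sequentially. \<bar>g (\<tau> m) * h x\<bar> < 2 * pi"
        by (auto intro!: order_tendstoD(2)[where a="2 * pi"])
      then have "\<forall>\<^sub>F m in sequentially. False"
      proof eventually_elim
        case (elim m)
        then show ?case
          using cos_ne_1[of "f (\<tau> m) * h x"] cos_ne_1[of "g (\<tau> m) * h x"] nz[OF \<tau>] hx
            \<open>\<forall>m. (1 - cos (f (\<tau> m) * h x)) * (1 - cos (g (\<tau> m) * h x)) = 0\<close>
          by (metis eq_iff_diff_eq_0 mult_eq_0_iff)
      qed
      then show False
        by simp
    qed
  qed
qed

section \<open>Limits of simple integrals\<close>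

context levy_basis
begin

text \<open>The integral of \<open>0\<close> vanishes; convergence on every Borel set enters only here.\<close>

lemma norm_cf_limit_eq_1:
  assumes F: "\<And>n. simple_integrand (F n)" and ae: "AE t in lborel. (\<lambda>n. F n t) \<longlonglongrightarrow> 0"
    and Z: "\<And>B. B \<in> sets borel \<Longrightarrow> \<exists>Z\<in>borel_measurable P. tendsto_in_prob P (\<lambda>n. integ B (F n)) Z"
    and Y: "tendsto_in_prob P (\<lambda>n. integ UNIV (F n)) Y" and [measurable]: "Y \<in> borel_measurable P"
    and nz: "cf P (\<lambda>\<omega>. r * Y \<omega>) \<noteq> 0"
  shows "cmod (cf P (\<lambda>\<omega>. r * Y \<omega>)) = 1"
proof -
  define g where "g n t = damping (r * F n t)" for n t
  have g_int: "integrable lborel (g n)" for n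
    using norm_cf_integ(1)[OF F[of n] F[of n], of UNIV r 0] by (simp add: g_def[abs_def])
  have g_nn: "g n t \<ge> 0" for n t
    by (simp add: g_def damping_nonneg)
  have norm_eq: "cmod (cf P (\<lambda>\<omega>. r * integ B (F n) \<omega>)) = exp (- (LINT t|lborel. indicator B t * g n t))"
    if "B \<in> sets borel" for B n
    using norm_cf_integ(2)[OF F[of n] F[of n] that, of r 0] by (simp add: g_def)
  have lim: "(\<lambda>n. exp (- (LINT t|lborel. indicator B t * g n t))) \<longlonglongrightarrow> cmod (cf P (\<lambda>\<omega>. r * Z \<omega>))"
    if "B \<in> sets borel" "Z \<in> borel_measurable P" "tendsto_in_prob P (\<lambda>n. integ B (F n)) Z" for B Z
  proof -
    have "(\<lambda>n. cf P (\<lambda>\<omega>. r * integ B (F n) \<omega> + 0 * integ B (F n) \<omega>)) \<longlonglongrightarrow> cf P (\<lambda>\<omega>. r * Z \<omega> + 0 * Z \<omega>)"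
      using that F by (intro tendsto_cf_in_prob) auto
    from tendsto_norm[OF this] show ?thesis
      using that(1) by (simp add: norm_eq)
  qed
  have limY: "(\<lambda>n. exp (- (LINT t|lborel. g n t))) \<longlonglongrightarrow> cmod (cf P (\<lambda>\<omega>. r * Y \<omega>))"
    using lim[of UNIV Y] Y by simp
  have "(\<lambda>n. LINT t|lborel. g n t) \<longlonglongrightarrow> 0"
  proof (rule integral_tendsto_zero_of_convergent_on_sets[OF g_int g_nn])
    have "isCont damping 0"
      using tendsto_damping_zero by (simp add: isCont_def)
    show "AE t in lborel. (\<lambda>n. g n t) \<longlonglongrightarrow> 0"
      using ae
    proof eventually_elim
      case (elim t)
      then have "(\<lambda>n. r * F n t) \<longlonglongrightarrow> r * 0"
        by (intro tendsto_intros)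
      then show ?case
        using isCont_tendsto_compose[OF \<open>isCont damping 0\<close>, of "\<lambda>n. r * F n t" sequentially] by (simp add: g_def)
    qed
  next
    fix B :: "real set" assume "B \<in> sets lborel"
    then have B: "B \<in> sets borel"
      by simp
    obtain Z where Z: "Z \<in> borel_measurable P" "tendsto_in_prob P (\<lambda>n. integ B (F n)) Z"
      using assms(3)[OF B] by auto
    have B_int: "integrable lborel (\<lambda>t. indicator B t * g n t)" for n
      using integrable_mult_indicator[of B lborel "g n"] B g_int by simp
    \<comment> \<open>Restriction to \<open>B\<close> lowers the exponent, so the limit modulus for
      \<open>Z\<close> is at least the nonzero one for \<open>Y\<close>. This permits the logarithm
      that turns convergence of moduli into convergence of integrals over \<open>B\<close>.\<close>
    have "cmod (cf P (\<lambda>\<omega>. r * Y \<omega>)) \<le> cmod (cf P (\<lambda>\<omega>. r * Z \<omega>))"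
    proof (rule LIMSEQ_le[OF limY lim[OF B Z]])
      have "(LINT t|lborel. indicator B t * g n t) \<le> (LINT t|lborel. g n t)" for n
        using B_int g_int g_nn by (intro integral_mono) (auto simp: indicator_def)
      then show "\<exists>N. \<forall>n\<ge>N. exp (- (LINT t|lborel. g n t)) \<le> exp (- (LINT t|lborel. indicator B t * g n t))"
        by auto
    qed
    then have "cmod (cf P (\<lambda>\<omega>. r * Z \<omega>)) > 0"
      using nz by (meson less_le_trans zero_less_norm_iff)
    then have "(\<lambda>n. - ln (exp (- (LINT t|lborel. indicator B t * g n t)))) \<longlonglongrightarrow> - ln (cmod (cf P (\<lambda>\<omega>. r * Z \<omega>)))"
      by (intro tendsto_intros lim[OF B Z]) auto
    then show "convergent (\<lambda>n. LINT t|lborel. indicator B t * g n t)"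
      by (auto simp: convergent_def)
  qed
  then have "(\<lambda>n. exp (- (LINT t|lborel. g n t))) \<longlonglongrightarrow> exp (- 0)"
    by (intro tendsto_intros)
  then show ?thesis
    using LIMSEQ_unique[OF limY] by simp
qed

end

text \<open>Adds the Levy-Khintchine form of the real part of the exponent: \<open>v\<close> is half
  the Gaussian variance, and \<open>h\<close> sends a jump to the coordinate under study.\<close>

locale levy_basis_jumps = levy_basis +
  fixes \<nu> :: "'c measure" and h :: "'c \<Rightarrow> real" and v :: real
  assumes v_nonneg: "v \<ge> 0"
    and integrable_one_minus_cos: "\<And>r. integrable \<nu> (\<lambda>x. 1 - cos (r * h x))"
    and damping_eq: "\<And>r. damping r = v * r\<^sup>2 + (LINT x|\<nu>. 1 - cos (r * h x))"
begin

definition jump_kernel :: "real \<Rightarrow> real \<Rightarrow> real" where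
  "jump_kernel p q = (LINT x|\<nu>. (1 - cos (p * h x)) * (1 - cos (q * h x)))"

lemma integrable_jump_kernel: "integrable \<nu> (\<lambda>x. (1 - cos (p * h x)) * (1 - cos (q * h x)))"
proof (rule Bochner_Integration.integrable_bound)
  show "integrable \<nu> (\<lambda>x. 2 * (1 - cos (p * h x)))"
    by (intro integrable_mult_right integrable_one_minus_cos)
  show "(\<lambda>x. (1 - cos (p * h x)) * (1 - cos (q * h x))) \<in> borel_measurable \<nu>"
    using integrable_one_minus_cos[of p] integrable_one_minus_cos[of q] by (intro borel_measurable_times) auto
  have le: "(1 - cos a) * (1 - cos b) \<le> (1 - cos a) * 2" for a b :: real
    using cos_ge_minus_one[of b] by (intro mult_left_mono) auto
  have "norm ((1 - cos (p * h x)) * (1 - cos (q * h x))) \<le> norm (2 * (1 - cos (p * h x)))" for x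
    using le[of "p * h x" "q * h x"] by (simp add: abs_mult)
  then show "AE x in \<nu>. norm ((1 - cos (p * h x)) * (1 - cos (q * h x))) \<le> norm (2 * (1 - cos (p * h x)))"
    by (rule AE_I2)
qed

text \<open>The second difference of \<open>damping\<close>, in which the Gaussian part cancels.\<close>

lemma jump_kernel_eq: "jump_kernel p q = damping p + damping q - (damping (p + q) + damping (p - q)) / 2"
proof -
  define C where "C a x = 1 - cos (a * h x)" for a x
  have C: "integrable \<nu> (C a)" for a
    using integrable_one_minus_cos unfolding C_def .
  have "C p x * C q x = C p x + C q x - (C (p + q) x + C (p - q) x) / 2" for x
    unfolding C_def
    by (simp add: distrib_right left_diff_distrib cos_add cos_diff) (simp add: field_simps)
  then have "jump_kernel p q = (LINT x|\<nu>. C p x) + (LINT x|\<nu>. C q x) - ((LINT x|\<nu>. C (p + q) x) + (LINT x|\<nu>. C (p - q) x)) / 2"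
    unfolding jump_kernel_def C_def[symmetric] using C by simp
  then show ?thesis
    unfolding damping_eq C_def[symmetric] by (simp add: power2_eq_square field_simps)
qed

text \<open>Independence makes negative log-moduli additive: if they are \<open>x\<close> for
  \<open>r * X\<close> and \<open>y\<close> for \<open>r * Y\<close>, they are \<open>x + y\<close>
  for both the sum and the difference. The combination in \<open>jump_kernel_eq\<close> then cancels
  in the limit, so the integrals of the nonnegative kernel tend to 0, and Fatou's lemma in each
  variable passes to \<open>f\<close> and \<open>g\<close>.\<close>

lemma AE_AE_of_indep:
  assumes F: "\<And>n. simple_integrand (F n)" and G: "\<And>n. simple_integrand (G n)"
    and f: "AE t in lborel. (\<lambda>n. F n t) \<longlonglongrightarrow> f t" and g: "AE t in lborel. (\<lambda>n. G n t) \<longlonglongrightarrow> g t"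
    and X: "tendsto_in_prob P (\<lambda>n. integ UNIV (F n)) X" and Y: "tendsto_in_prob P (\<lambda>n. integ UNIV (G n)) Y"
    and [measurable]: "X \<in> borel_measurable P" "Y \<in> borel_measurable P"
    and indep: "\<And>p q. cf P (\<lambda>\<omega>. p * X \<omega> + q * Y \<omega>) = cf P (\<lambda>\<omega>. p * X \<omega>) * cf P (\<lambda>\<omega>. q * Y \<omega>)"
    and nz: "cf P (\<lambda>\<omega>. r * X \<omega>) \<noteq> 0" "cf P (\<lambda>\<omega>. r * Y \<omega>) \<noteq> 0"
  shows "AE t in lborel. AE x in \<nu>. (1 - cos (r * f t * h x)) * (1 - cos (r * g t * h x)) = 0"
proof -
  have int: "integrable lborel (\<lambda>t. damping (p * F n t + q * G n t))" for p q n
    using norm_cf_integ(1)[OF F[of n] G[of n], of UNIV p q] by simp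
  have norm_lim: "(\<lambda>n. exp (- (LINT t|lborel. damping (p * F n t + q * G n t)))) \<longlonglongrightarrow>
      cmod (cf P (\<lambda>\<omega>. p * X \<omega>)) * cmod (cf P (\<lambda>\<omega>. q * Y \<omega>))" for p q
  proof -
    have "(\<lambda>n. cf P (\<lambda>\<omega>. p * integ UNIV (F n) \<omega> + q * integ UNIV (G n) \<omega>)) \<longlonglongrightarrow> cf P (\<lambda>\<omega>. p * X \<omega> + q * Y \<omega>)"
      using F G X Y by (intro tendsto_cf_in_prob) auto
    from tendsto_norm[OF this] show ?thesis
      using norm_cf_integ(2)[OF F G, where B=UNIV and p=p and q=q] by (simp add: indep norm_mult)
  qed
  have lim: "(\<lambda>n. LINT t|lborel. damping (p * F n t + q * G n t)) \<longlonglongrightarrow>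
      - ln (cmod (cf P (\<lambda>\<omega>. p * X \<omega>))) - ln (cmod (cf P (\<lambda>\<omega>. q * Y \<omega>)))"
    if "cf P (\<lambda>\<omega>. p * X \<omega>) \<noteq> 0" "cf P (\<lambda>\<omega>. q * Y \<omega>) \<noteq> 0" for p q
  proof -
    have "(\<lambda>n. - ln (exp (- (LINT t|lborel. damping (p * F n t + q * G n t))))) \<longlonglongrightarrow>
      - ln (cmod (cf P (\<lambda>\<omega>. p * X \<omega>)) * cmod (cf P (\<lambda>\<omega>. q * Y \<omega>)))"
      using that by (intro tendsto_intros norm_lim) auto
    then show ?thesis
      using that by (simp add: ln_mult)
  qed
  \<comment> \<open>The frequency \<open>- r\<close> produces the difference; conjugation leaves the
    modulus unchanged and nonzero.\<close>
  have "cf P (\<lambda>\<omega>. - (r * Y \<omega>)) = cnj (cf P (\<lambda>\<omega>. r * Y \<omega>))"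
    by (rule cf_uminus)
  then have cf_minus: "cmod (cf P (\<lambda>\<omega>. (- r) * Y \<omega>)) = cmod (cf P (\<lambda>\<omega>. r * Y \<omega>))"
    by simp
  have nz': "cf P (\<lambda>\<omega>. (- r) * Y \<omega>) \<noteq> 0"
    using cf_minus nz(2) by (metis norm_eq_zero)
  \<comment> \<open>The zero coefficients bring all four terms into the shape treated by
    \<open>int\<close> and \<open>lim\<close>.\<close>
  have kernel_n: "(\<lambda>t. jump_kernel (r * F n t) (r * G n t)) = (\<lambda>t. damping (r * F n t + 0 * G n t) + damping (0 * F n t + r * G n t) -
      (damping (r * F n t + r * G n t) + damping (r * F n t + (- r) * G n t)) / 2)" for n
    by (simp add: jump_kernel_eq)
  have lin: "(LINT t|lborel. a t + b t - (c t + d t) / 2) =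
      (LINT t|lborel. a t) + (LINT t|lborel. b t) - ((LINT t|lborel. c t) + (LINT t|lborel. d t)) / 2"
    if "integrable lborel a" "integrable lborel b" "integrable lborel c" "integrable lborel d"
    for a b c d :: "real \<Rightarrow> real"
    using that by simp
  let ?x = "- ln (cmod (cf P (\<lambda>\<omega>. r * X \<omega>)))" and ?y = "- ln (cmod (cf P (\<lambda>\<omega>. r * Y \<omega>)))"
  have "(\<lambda>n. LINT t|lborel. jump_kernel (r * F n t) (r * G n t)) = (\<lambda>n. (LINT t|lborel. damping (r * F n t + 0 * G n t)) +
      (LINT t|lborel. damping (0 * F n t + r * G n t)) - ((LINT t|lborel. damping (r * F n t + r * G n t)) +
      (LINT t|lborel. damping (r * F n t + (- r) * G n t))) / 2)"
    unfolding kernel_n by (intro ext lin int)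
  moreover have "\<dots> \<longlonglongrightarrow> ?x + ?y - ((?x + ?y) + (?x + ?y)) / 2"
  proof (intro tendsto_intros)
    show "(\<lambda>n. LINT t|lborel. damping (r * F n t + 0 * G n t)) \<longlonglongrightarrow> ?x"
      using lim[of r 0] nz by simp
    show "(\<lambda>n. LINT t|lborel. damping (0 * F n t + r * G n t)) \<longlonglongrightarrow> ?y"
      using lim[of 0 r] nz by simp
    show "(\<lambda>n. LINT t|lborel. damping (r * F n t + r * G n t)) \<longlonglongrightarrow> ?x + ?y"
      using lim[of r r] nz by simp
    show "(\<lambda>n. LINT t|lborel. damping (r * F n t + (- r) * G n t)) \<longlonglongrightarrow> ?x + ?y"
      using lim[OF nz(1) nz'] unfolding cf_minus by simp
  qed simp
  moreover have "?x + ?y - ((?x + ?y) + (?x + ?y)) / 2 = 0"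
    by (simp add: field_simps)
  ultimately have lim_kernel: "(\<lambda>n. LINT t|lborel. jump_kernel (r * F n t) (r * G n t)) \<longlonglongrightarrow> 0"
    by (simp only:)
  show ?thesis
  proof (rule AE_AE_zero_of_integral_tendsto_zero)
    show "integrable lborel (\<lambda>t. LINT x|\<nu>. (1 - cos (r * F n t * h x)) * (1 - cos (r * G n t * h x)))" for n
      unfolding jump_kernel_def[symmetric] kernel_n
      by (intro Bochner_Integration.integrable_add Bochner_Integration.integrable_diff integrable_divide int)
    show "integrable \<nu> (\<lambda>x. (1 - cos (r * F n t * h x)) * (1 - cos (r * G n t * h x)))" for n t
      by (rule integrable_jump_kernel)
    show "(1 - cos (r * F n t * h x)) * (1 - cos (r * G n t * h x)) \<ge> 0" for n t x
      by simp
    show "(\<lambda>n. LINT t|lborel. LINT x|\<nu>. (1 - cos (r * F n t * h x)) * (1 - cos (r * G n t * h x))) \<longlonglongrightarrow> 0"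
      using lim_kernel unfolding jump_kernel_def .
    show "AE t in lborel. \<forall>x. (\<lambda>n. (1 - cos (r * F n t * h x)) * (1 - cos (r * G n t * h x))) \<longlonglongrightarrow>
        (1 - cos (r * f t * h x)) * (1 - cos (r * g t * h x))"
      using f g by eventually_elim (auto intro!: tendsto_intros)
  qed
qed

text \<open>Modulus 1 forces the integrals of \<open>damping\<close> to 0. Since the Gaussian part
  is nonnegative, the jump part is squeezed between 0 and \<open>damping\<close>, and Fatou's lemma
  applies to it.\<close>

lemma AE_AE_of_norm_cf_eq_1:
  assumes G: "\<And>n. simple_integrand (G n)" and g: "AE t in lborel. (\<lambda>n. G n t) \<longlonglongrightarrow> g t"
    and Y: "tendsto_in_prob P (\<lambda>n. integ UNIV (G n)) Y" and [measurable]: "Y \<in> borel_measurable P"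
    and one: "cmod (cf P (\<lambda>\<omega>. r * Y \<omega>)) = 1"
  shows "AE t in lborel. AE x in \<nu>. 1 - cos (r * g t * h x) = 0"
proof -
  have int: "integrable lborel (\<lambda>t. damping (r * G n t))" for n
    using norm_cf_integ(1)[OF G[of n] G[of n], of UNIV r 0] by simp
  have "(\<lambda>n. cf P (\<lambda>\<omega>. r * integ UNIV (G n) \<omega> + 0 * integ UNIV (G n) \<omega>)) \<longlonglongrightarrow> cf P (\<lambda>\<omega>. r * Y \<omega> + 0 * Y \<omega>)"
    using G Y by (intro tendsto_cf_in_prob) auto
  from tendsto_norm[OF this] have "(\<lambda>n. exp (- (LINT t|lborel. damping (r * G n t)))) \<longlonglongrightarrow> 1"
    using norm_cf_integ(2)[OF G G, where B=UNIV and p=r and q=0] one by simp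
  then have "(\<lambda>n. - ln (exp (- (LINT t|lborel. damping (r * G n t))))) \<longlonglongrightarrow> - ln 1"
    by (intro tendsto_intros) auto
  then have lim: "(\<lambda>n. LINT t|lborel. damping (r * G n t)) \<longlonglongrightarrow> 0"
    by simp
  let ?J = "\<lambda>n t. LINT x|\<nu>. 1 - cos (r * G n t * h x)"
  have J_nn: "?J n t \<ge> 0" for n t
    by (intro Bochner_Integration.integral_nonneg) simp
  have J_le: "?J n t \<le> damping (r * G n t)" for n t
    unfolding damping_eq using v_nonneg by simp
  have J_int: "integrable lborel (?J n)" for n
  proof (rule Bochner_Integration.integrable_bound[OF int[of n]])
    have [measurable]: "G n \<in> borel_measurable lborel" "(\<lambda>t. damping (r * G n t)) \<in> borel_measurable lborel"
      using G[of n] int[of n] by (auto simp: simple_integrand_def borel_measurable_simple_function)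
    \<comment> \<open>Measurability in \<open>t\<close> is obtained by subtracting the Gaussian part
      from \<open>damping\<close>, instead of by a Fubini argument for \<nu>.\<close>
    have "?J n = (\<lambda>t. damping (r * G n t) - v * (r * G n t)\<^sup>2)"
      by (simp add: damping_eq)
    then show "?J n \<in> borel_measurable lborel"
      by simp
  qed (use J_nn J_le damping_nonneg in auto)
  show ?thesis
  proof (rule AE_AE_zero_of_integral_tendsto_zero)
    show "(\<lambda>n. LINT t|lborel. ?J n t) \<longlonglongrightarrow> 0"
    proof (rule tendsto_sandwich[OF _ _ tendsto_const lim])
      show "\<forall>\<^sub>F n in sequentially. 0 \<le> (LINT t|lborel. ?J n t)"
        by (intro always_eventually allI Bochner_Integration.integral_nonneg J_nn)
      show "\<forall>\<^sub>F n in sequentially. (LINT t|lborel. ?J n t) \<le> (LINT t|lborel. damping (r * G n t))"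
        by (intro always_eventually allI integral_mono J_int int J_le)
    qed
    show "AE t in lborel. \<forall>x. (\<lambda>n. 1 - cos (r * G n t * h x)) \<longlonglongrightarrow> 1 - cos (r * g t * h x)"
      using g by eventually_elim (auto intro!: tendsto_intros)
  qed (simp_all add: J_int integrable_one_minus_cos)
qed

end

section \<open>Regularly varying measures do not vanish\<close>

text \<open>Tychonoff's theorem carried over along \<open>vec_lambda\<close>. For
  \<open>ereal\<close> it makes closed sets of extended vectors compact, as test functions for vague
  convergence require.\<close>

lemma compact_UNIV_vec: "compact (UNIV :: ('b::topological_space ^ 'n) set)" if "compact (UNIV :: 'b set)"
proof -
  have "compactin (product_topology (\<lambda>_::'n. euclidean :: 'b topology) UNIV) (PiE UNIV (\<lambda>_. UNIV))"
    using that by (subst compactin_PiE) simp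
  then have "compact (UNIV :: ('n \<Rightarrow> 'b) set)"
    by (simp add: euclidean_product_topology PiE_UNIV_domain)
  moreover have "continuous_on UNIV (vec_lambda :: ('n \<Rightarrow> 'b) \<Rightarrow> 'b ^ 'n)"
    using continuous_on_vec_lambda[of UNIV "\<lambda>i f. f i"] by (simp add: continuous_on_product_coordinates)
  ultimately have "compact (range (vec_lambda :: ('n \<Rightarrow> 'b) \<Rightarrow> 'b ^ 'n))"
    by (metis compact_continuous_image)
  moreover have "range (vec_lambda :: ('n \<Rightarrow> 'b) \<Rightarrow> 'b ^ 'n) = UNIV"
    by (metis surj_def vec_nth_inverse)
  ultimately show ?thesis
    by simp
qed

text \<open>A bounded continuous function on the extended line vanishing only at 0; summing its
  absolute values over the coordinates gives a substitute for a norm on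
  \<open>ereal ^ 'n\<close>.\<close>

definition clip :: "ereal \<Rightarrow> real" where
  "clip y = real_of_ereal (max (ereal (- 1)) (min y (ereal 1)))"

lemma clip_simps: "clip (ereal x) = max (- 1) (min x 1)" "clip \<infinity> = 1" "clip (- \<infinity>) = - 1"
proof -
  show "clip (ereal x) = max (- 1) (min x 1)"
    by (simp only: clip_def ereal_min[symmetric] ereal_max[symmetric] real_of_ereal.simps)
  have "min \<infinity> (ereal 1) = ereal 1" "min (- \<infinity>) (ereal 1) = - \<infinity>" "max (ereal (- 1)) (- \<infinity>) = ereal (- 1)"
    by (simp_all add: min_def max_def)
  then show "clip \<infinity> = 1" "clip (- \<infinity>) = - 1"
    by (simp_all only: clip_def ereal_max[symmetric] real_of_ereal.simps)
qed

lemma continuous_on_clip: "continuous_on UNIV clip"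
  unfolding continuous_on_def
proof
  fix y :: ereal
  have fin: "ereal (clip y) = max (ereal (- 1)) (min y (ereal 1))"
  proof -
    have "ereal (- 1) \<le> max (ereal (- 1)) (min y (ereal 1))"
      by (rule max.cobounded1)
    moreover have "max (ereal (- 1)) (min y (ereal 1)) \<le> ereal 1"
      by (intro max.boundedI min.cobounded2) (simp only: ereal_less_eq)
    ultimately have "\<bar>max (ereal (- 1)) (min y (ereal 1))\<bar> \<noteq> \<infinity>"
      by (cases "max (ereal (- 1)) (min y (ereal 1))") auto
    then show ?thesis
      unfolding clip_def by (simp only: ereal_real if_False)
  qed
  have "((\<lambda>y. max (ereal (- 1)) (min y (ereal 1))) \<longlongrightarrow> ereal (clip y)) (at y)"
    unfolding fin by (intro tendsto_intros)
  then show "(clip \<longlongrightarrow> clip y) (at y within UNIV)"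
    unfolding clip_def[abs_def] by (rule lim_real_of_ereal[unfolded o_def])
qed

lemma measurable_ereal_vec_scaleR: "(\<lambda>x. ereal_vec (c *\<^sub>R x)) \<in> borel_measurable borel"
  unfolding ereal_vec_def
  by (intro borel_measurable_continuous_onI continuous_intros)

text \<open>If \<nu> were null, so would be all its rescalings, and the vague limit
  \<open>\<kappa>\<close> would integrate every test function to 0. Suitable test functions are
  positive on sets that exhaust the complement of the origin, against \<open>\<kappa>\<close> being
  nonzero.\<close>

lemma regularly_varying_measure_nonzero:
  fixes \<nu> :: "(real ^ 'n) measure"
  assumes "regularly_varying_measure \<nu> \<alpha>"
  shows "emeasure \<nu> UNIV \<noteq> 0"
proof
  assume zero: "emeasure \<nu> UNIV = 0"
  have \<nu>_sets: "sets \<nu> = sets borel"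
    using assms by (simp add: regularly_varying_measure_def)
  obtain l and \<kappa> :: "(ereal ^ 'n) measure" where \<kappa>: "radon_measure_on (- {0}) \<kappa>" "emeasure \<kappa> (- {0}) \<noteq> 0"
    "vaguely_tendsto_on (- {0})
      (\<lambda>u. scale_measure (ennreal (u powr \<alpha> * l u)) (distr \<nu> borel (\<lambda>x. ereal_vec (inverse u *\<^sub>R x)))) \<kappa> at_top"
    using assms unfolding regularly_varying_measure_def by blast
  have [measurable_cong]: "sets \<kappa> = sets borel"
    using \<kappa>(1) by (simp add: radon_measure_on_def)
  define \<phi> where "\<phi> x = (\<Sum>i\<in>UNIV. \<bar>clip (x $ i)\<bar>)" for x :: "ereal ^ 'n"
  have \<phi>_cont: "continuous_on UNIV \<phi>"
    unfolding \<phi>_def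
    by (intro continuous_intros continuous_on_compose2[OF continuous_on_clip] continuous_on_component) auto
  have \<phi>_pos: "\<phi> x > 0 \<longleftrightarrow> x \<noteq> 0" for x
  proof -
    have "clip y = 0 \<longleftrightarrow> y = 0" for y :: ereal
      by (cases y) (auto simp: clip_simps min_def max_def split: if_splits)
    then have "\<phi> x = 0 \<longleftrightarrow> x = 0"
      unfolding \<phi>_def by (subst sum_nonneg_eq_0_iff) (auto simp: vec_eq_iff)
    moreover have "\<phi> x \<ge> 0"
      unfolding \<phi>_def by (intro sum_nonneg) auto
    ultimately show ?thesis
      by linarith
  qed
  have \<phi>_le: "\<phi> x \<le> CARD('n)" for x
  proof -
    have "\<bar>clip y\<bar> \<le> 1" for y :: ereal
      by (cases y) (auto simp: clip_simps)
    then have "\<phi> x \<le> (\<Sum>i\<in>(UNIV::'n set). 1)"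
      unfolding \<phi>_def by (intro sum_mono) auto
    then show ?thesis
      by simp
  qed
  have null: "emeasure \<kappa> {x. \<phi> x > 1 / real (Suc m)} = 0" for m
  proof -
    \<comment> \<open>The cut-off confines the support to a compact set avoiding the origin, while
      \<open>f\<close> is positive exactly on the set to be shown null.\<close>
    define f where "f x = max 0 (\<phi> x - 1 / real (Suc m))" for x
    define K where "K = {x. \<phi> x \<ge> 1 / real (Suc m)}"
    have "closed K"
      unfolding K_def by (intro closed_Collect_le continuous_on_const \<phi>_cont)
    then have "compact K"
      using closed_Int_compact[of K UNIV] compact_UNIV_vec[OF Extended_Real_Limits.compact_UNIV] by simp
    moreover have K0: "K \<subseteq> - {0}"
    proof
      fix x assume "x \<in> K"
      then have "\<phi> x > 0"
        unfolding K_def by (auto intro: less_le_trans[of 0 "1 / real (Suc m)"])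
      then show "x \<in> - {0}"
        using \<phi>_pos by simp
    qed
    moreover have f0: "f x = 0" if "x \<notin> K" for x
      using that by (auto simp: f_def K_def)
    moreover have f_cont: "continuous_on UNIV f"
      unfolding f_def by (intro continuous_intros \<phi>_cont)
    ultimately have lim: "((\<lambda>u. LINT x|scale_measure (ennreal (u powr \<alpha> * l u))
        (distr \<nu> borel (\<lambda>x. ereal_vec (inverse u *\<^sub>R x))). f x) \<longlongrightarrow> (LINT x|\<kappa>. f x)) at_top"
      using \<kappa>(3) continuous_on_subset[of UNIV f "- {0}"] unfolding vaguely_tendsto_on_def by blast
    have [measurable]: "f \<in> borel_measurable borel"
      by (rule borel_measurable_continuous_onI[OF f_cont])
    have "(LINT x|scale_measure (ennreal (u powr \<alpha> * l u)) (distr \<nu> borel (\<lambda>x. ereal_vec (inverse u *\<^sub>R x))). f x) = 0" for u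
    proof (rule integral_eq_zero_AE)
      let ?D = "scale_measure (ennreal (u powr \<alpha> * l u)) (distr \<nu> borel (\<lambda>x. ereal_vec (inverse u *\<^sub>R x)))"
      have "(\<lambda>x. ereal_vec (inverse u *\<^sub>R x)) \<in> measurable \<nu> borel"
        using measurable_ereal_vec_scaleR \<nu>_sets by (metis measurable_cong_sets)
      moreover have "space \<nu> = UNIV"
        using sets_eq_imp_space_eq[OF \<nu>_sets] by simp
      ultimately have "emeasure ?D UNIV = 0"
        using zero by (simp add: emeasure_distr)
      then have "UNIV \<in> null_sets ?D"
        by (auto simp: null_sets_def)
      then show "AE x in ?D. f x = 0"
        by (rule AE_I') simp
    qed
    then have int0: "(LINT x|\<kappa>. f x) = 0"
      using lim by (simp add: tendsto_const_iff)
    have f_nn: "f x \<ge> 0" for x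
      by (simp add: f_def)
    \<comment> \<open>A vanishing Bochner integral is conclusive only for an integrable function,
      the default value being 0 too.\<close>
    have "integrable \<kappa> f"
    proof (rule Bochner_Integration.integrable_bound)
      have "emeasure \<kappa> K < \<infinity>"
        using \<kappa>(1) \<open>compact K\<close> K0 by (auto simp: radon_measure_on_def)
      then show "integrable \<kappa> (\<lambda>x. real CARD('n) * indicator K x)"
        using \<open>closed K\<close> by (intro integrable_mult_right) (auto simp: integrable_indicator_iff)
      have "0 \<le> 1 / real (Suc m)"
        by simp
      then have le: "\<phi> x - 1 / real (Suc m) \<le> real CARD('n)" for x
        using \<phi>_le[of x] by linarith
      have "norm (f x) \<le> norm (real CARD('n) * indicator K x)" for x
        using f0[of x] le[of x] by (cases "x \<in> K") (auto simp: f_def simp del: of_nat_Suc)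
      then show "AE x in \<kappa>. norm (f x) \<le> norm (real CARD('n) * indicator K x)"
        by simp
    qed measurable
    then have "AE x in \<kappa>. f x = 0"
      using int0 f_nn by (subst integral_nonneg_eq_0_iff_AE[symmetric]) auto
    then have "AE x in \<kappa>. x \<notin> {x. \<phi> x > 1 / real (Suc m)}"
      by eventually_elim (auto simp: f_def)
    moreover have "{x. \<phi> x > 1 / real (Suc m)} \<in> sets \<kappa>"
      using borel_measurable_continuous_onI[OF \<phi>_cont] by measurable
    ultimately show ?thesis
      by (subst (asm) AE_iff_null_sets[symmetric]) auto
  qed
  have "- {0} = (\<Union>m. {x. \<phi> x > 1 / real (Suc m)})"
  proof (intro set_eqI iffI)
    fix x assume "x \<in> - {0::ereal ^ 'n}"
    then show "x \<in> (\<Union>m. {x. \<phi> x > 1 / real (Suc m)})"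
      using reals_Archimedean[of "\<phi> x"] \<phi>_pos[of x] by (auto simp: inverse_eq_divide)
  next
    fix x assume "x \<in> (\<Union>m. {x. \<phi> x > 1 / real (Suc m)})"
    then show "x \<in> - {0}"
      using \<phi>_pos[of x] by (force intro: le_less_trans[rotated])
  qed
  moreover have "emeasure \<kappa> (\<Union>m. {x. \<phi> x > 1 / real (Suc m)}) = 0"
    using null borel_measurable_continuous_onI[OF \<phi>_cont]
    by (intro emeasure_UN_eq_0) auto
  ultimately show False
    using \<kappa>(2) by simp
qed

section \<open>Coordinates of the Levy basis\<close>

text \<open>Inside the unit ball the integrand is a second-order Taylor remainder; outside, the
  compensator is absent and the bound is 2. Both fit under a multiple of the function that a Levy
  measure integrates.\<close>

lemma levy_exponent_integrand_integrable:
  fixes \<nu> :: "(real ^ 'n) measure" and z :: "real ^ 'n"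
  assumes "levy_measure \<nu>"
  shows "integrable \<nu> (\<lambda>x. exp (\<i> * of_real (z \<bullet> x)) - 1 - \<i> * of_real (z \<bullet> x) * indicator {0..1} (norm x))"
    (is "integrable \<nu> ?f")
proof (rule Bochner_Integration.integrable_bound)
  have [measurable_cong]: "sets \<nu> = sets borel"
    using assms by (simp add: levy_measure_def)
  have "integrable \<nu> (\<lambda>x. min 1 ((norm x)\<^sup>2))"
    using assms by (intro integrableI_nonneg) (auto simp: levy_measure_def)
  then show "integrable \<nu> (\<lambda>x. (2 + (norm z)\<^sup>2) * min 1 ((norm x)\<^sup>2))"
    by (rule integrable_mult_right)
  show "?f \<in> borel_measurable \<nu>"
    by measurable
  have "norm (?f x) \<le> norm ((2 + (norm z)\<^sup>2) * min 1 ((norm x)\<^sup>2))" for x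
  proof (cases "norm x \<le> 1")
    case True
    let ?u = "z \<bullet> x"
    have "norm (?f x) \<le> ?u\<^sup>2 / 2"
      using iexp_approx1[of ?u 1] True by (simp add: algebra_simps numeral_2_eq_2)
    also have "\<dots> \<le> ?u\<^sup>2"
      by simp
    also have "\<dots> \<le> (norm z * norm x)\<^sup>2"
      by (rule abs_le_square_iff[THEN iffD1]) (simp add: Cauchy_Schwarz_ineq2)
    also have "\<dots> \<le> (2 + (norm z)\<^sup>2) * (norm x)\<^sup>2"
      unfolding power_mult_distrib by (rule mult_right_mono) auto
    also have "(norm x)\<^sup>2 = min 1 ((norm x)\<^sup>2)"
      using True by (intro min_absorb2[symmetric] power_le_one) auto
    finally show ?thesis
      by (simp add: min_def)
  next
    case False
    then have "norm (?f x) \<le> 2"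
      using norm_triangle_ineq4[of "exp (\<i> * of_real (z \<bullet> x))" 1] by simp
    also have "\<dots> \<le> 2 + (norm z)\<^sup>2"
      by simp
    also have "min 1 ((norm x)\<^sup>2) = 1"
      using False by (simp add: min_def)
    then have "2 + (norm z)\<^sup>2 = (2 + (norm z)\<^sup>2) * min 1 ((norm x)\<^sup>2)"
      by simp
    finally show ?thesis
      by simp
  qed
  then show "AE x in \<nu>. norm (?f x) \<le> norm ((2 + (norm z)\<^sup>2) * min 1 ((norm x)\<^sup>2))"
    by (rule AE_I2)
qed

text \<open>Drift and compensator are purely imaginary; integrability allows the real part to be
  taken under the integral.\<close>

lemma Re_levy_exponent:
  fixes \<nu> :: "(real ^ 'n) measure"
  assumes "levy_measure \<nu>"
  shows "integrable \<nu> (\<lambda>x. 1 - cos (z \<bullet> x))"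
    and "- Re (levy_exponent \<gamma> S \<nu> z) = (z \<bullet> (S *v z)) / 2 + (LINT x|\<nu>. 1 - cos (z \<bullet> x))"
proof -
  let ?f = "\<lambda>x. exp (\<i> * of_real (z \<bullet> x)) - 1 - \<i> * of_real (z \<bullet> x) * indicator {0..1} (norm x)"
  have int: "integrable \<nu> ?f"
    by (rule levy_exponent_integrand_integrable[OF assms])
  have Re_f: "- Re (?f x) = 1 - cos (z \<bullet> x)" for x
    by (simp add: Re_exp indicator_def)
  have "integrable \<nu> (\<lambda>x. - Re (?f x))"
    using int by (intro Bochner_Integration.integrable_minus integrable_Re)
  then show "integrable \<nu> (\<lambda>x. 1 - cos (z \<bullet> x))"
    unfolding Re_f .
  have "Re (CLINT x|\<nu>. ?f x) = (LINT x|\<nu>. Re (?f x))"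
    using int by (rule integral_Re[symmetric])
  then have "- Re (CLINT x|\<nu>. ?f x) = (LINT x|\<nu>. - Re (?f x))"
    by (simp only: Bochner_Integration.integral_minus)
  then have "- Re (CLINT x|\<nu>. ?f x) = (LINT x|\<nu>. 1 - cos (z \<bullet> x))"
    unfolding Re_f .
  then show "- Re (levy_exponent \<gamma> S \<nu> z) = (z \<bullet> (S *v z)) / 2 + (LINT x|\<nu>. 1 - cos (z \<bullet> x))"
    unfolding levy_exponent_def by simp
qed

text \<open>Stationarity moves the increment to start at time 0, where the process vanishes almost
  surely; at the positive time \<open>b - a\<close> sign and absolute value are trivial.\<close>

lemma cf_levy_increment:
  fixes L :: "real \<Rightarrow> 'a \<Rightarrow> real ^ 'n"
  assumes L: "two_sided_levy_process P L \<gamma> S \<nu>" and "a < b"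
  shows "cf P (\<lambda>\<omega>. z \<bullet> (L b \<omega> - L a \<omega>)) = exp (of_real (b - a) * levy_exponent \<gamma> S \<nu> z)"
proof -
  have [measurable]: "\<And>t. L t \<in> borel_measurable P"
    using L by (simp add: two_sided_levy_process_def)
  have d: "distr P borel (\<lambda>\<omega>. L b \<omega> - L a \<omega>) = distr P borel (\<lambda>\<omega>. L (b - a) \<omega> - L 0 \<omega>)"
  proof -
    have "\<forall>s t h. s \<le> t \<longrightarrow>
        distr P borel (\<lambda>\<omega>. L (t + h) \<omega> - L (s + h) \<omega>) = distr P borel (\<lambda>\<omega>. L t \<omega> - L s \<omega>)"
      using L unfolding two_sided_levy_process_def by (elim conjE)
    from this[rule_format, of 0 "b - a" a] show ?thesis
      using \<open>a < b\<close> by simp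
  qed
  have "cf P (\<lambda>\<omega>. z \<bullet> (L b \<omega> - L a \<omega>)) = (CLINT x|distr P borel (\<lambda>\<omega>. L b \<omega> - L a \<omega>). iexp (z \<bullet> x))"
    unfolding cf_def by (rule integral_distr[symmetric]) measurable
  also have "\<dots> = (CLINT \<omega>|P. iexp (z \<bullet> (L (b - a) \<omega> - L 0 \<omega>)))"
    unfolding d by (rule integral_distr) measurable
  also have "\<dots> = (CLINT \<omega>|P. iexp (z \<bullet> L (b - a) \<omega>))"
  proof (rule integral_cong_AE)
    have "AE \<omega> in P. L 0 \<omega> = 0"
      using L by (simp add: two_sided_levy_process_def)
    then show "AE \<omega> in P. iexp (z \<bullet> (L (b - a) \<omega> - L 0 \<omega>)) = iexp (z \<bullet> L (b - a) \<omega>)"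
      by eventually_elim simp
  qed measurable
  also have "\<dots> = exp (of_real (b - a) * levy_exponent \<gamma> S \<nu> z)"
    using L \<open>a < b\<close> unfolding two_sided_levy_process_def by simp
  finally show ?thesis .
qed

text \<open>Frequencies along \<open>axis i 1\<close> isolate coordinate \<open>i\<close>, so the
  Gaussian coefficient is half the corresponding diagonal entry of \<open>S\<close>.\<close>

lemma levy_basis_jumps_component:
  fixes L :: "real \<Rightarrow> 'a \<Rightarrow> real ^ 'n"
  assumes L: "two_sided_levy_process P L \<gamma> S \<nu>" and \<Lambda>: "levy_random_measure P L \<Lambda>"
  shows "levy_basis_jumps P (\<lambda>B \<omega>. \<Lambda> B \<omega> $ i) (\<lambda>r. levy_exponent \<gamma> S \<nu> (r *\<^sub>R axis i 1)) \<nu> (\<lambda>x. x $ i)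
    ((axis i 1 \<bullet> (S *v axis i 1)) / 2)"
proof -
  interpret prob_space P
    using L by (simp add: two_sided_levy_process_def)
  have trip: "generating_triplet \<gamma> S \<nu>"
    using L by (simp add: two_sided_levy_process_def)
  have [measurable]: "\<And>t. L t \<in> borel_measurable P" "\<And>B. B \<in> bounded_borel \<Longrightarrow> \<Lambda> B \<in> borel_measurable P"
    using L \<Lambda> by (auto simp: two_sided_levy_process_def levy_random_measure_def)
  have nth [measurable]: "(\<lambda>x. x $ i) \<in> borel_measurable (borel :: (real ^ 'n) measure)"
    by (intro borel_measurable_continuous_onI continuous_intros)
  have basis: "levy_basis P (\<lambda>B \<omega>. \<Lambda> B \<omega> $ i) (\<lambda>r. levy_exponent \<gamma> S \<nu> (r *\<^sub>R axis i 1))"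
  proof unfold_locales
    show "(\<lambda>\<omega>. \<Lambda> B \<omega> $ i) \<in> borel_measurable P" if "B \<in> bounded_borel" for B
      using that by measurable
    show "indep_vars (\<lambda>_. borel) (\<lambda>k \<omega>. \<Lambda> (B k) \<omega> $ i) {..<n}"
      if "\<And>k. k < n \<Longrightarrow> B k \<in> bounded_borel" "disjoint_family_on B {..<n}" for n :: nat and B
    proof -
      have "indep_vars (\<lambda>_. borel) (\<lambda>k. \<Lambda> (B k)) {..<n}"
        using \<Lambda> that unfolding levy_random_measure_def by blast
      then show ?thesis
        by (rule indep_vars_compose2) (rule nth)
    qed
    show "AE \<omega> in P. (\<lambda>k. \<Lambda> (B k) \<omega> $ i) sums (\<Lambda> (\<Union>k. B k) \<omega> $ i)"
      if "range B \<subseteq> bounded_borel" "disjoint_family B" "(\<Union>k. B k) \<in> bounded_borel" for B :: "nat \<Rightarrow> real set"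
    proof -
      have "AE \<omega> in P. (\<lambda>k. \<Lambda> (B k) \<omega>) sums \<Lambda> (\<Union>k. B k) \<omega>"
        using \<Lambda> that unfolding levy_random_measure_def by blast
      then show ?thesis
        by eventually_elim (auto simp: sums_def simp flip: sum_component intro: tendsto_vec_nth)
    qed
    show "cf P (\<lambda>\<omega>. r * (\<Lambda> {a..<b} \<omega> $ i)) = exp (of_real (b - a) * levy_exponent \<gamma> S \<nu> (r *\<^sub>R axis i 1))"
      if "a < b" for a b r
    proof -
      have [measurable]: "\<Lambda> {a..<b} \<in> borel_measurable P"
        by measurable (simp add: bounded_borel_def)
      have "AE \<omega> in P. \<Lambda> {a..<b} \<omega> = L b \<omega> - L a \<omega>"
        using \<Lambda> that by (simp add: levy_random_measure_def)
      then have "AE \<omega> in P. r * (\<Lambda> {a..<b} \<omega> $ i) = (r *\<^sub>R axis i 1) \<bullet> (L b \<omega> - L a \<omega>)"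
        by eventually_elim (simp add: inner_axis')
      then have "cf P (\<lambda>\<omega>. r * (\<Lambda> {a..<b} \<omega> $ i)) = cf P (\<lambda>\<omega>. (r *\<^sub>R axis i 1) \<bullet> (L b \<omega> - L a \<omega>))"
        by (intro cf_cong_AE) measurable
      also have "\<dots> = exp (of_real (b - a) * levy_exponent \<gamma> S \<nu> (r *\<^sub>R axis i 1))"
        by (rule cf_levy_increment[OF L that])
      finally show ?thesis .
    qed
  qed
  have \<nu>: "levy_measure \<nu>"
    using trip by (simp add: generating_triplet_def)
  have inner: "(r *\<^sub>R axis i 1) \<bullet> x = r * x $ i" for r and x :: "real ^ 'n"
    by (simp add: inner_axis')
  show ?thesis
  proof (intro levy_basis_jumps.intro basis, unfold_locales)
    show "0 \<le> (axis i 1 \<bullet> (S *v axis i 1)) / 2"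
      using trip by (simp add: generating_triplet_def)
    show "integrable \<nu> (\<lambda>x. 1 - cos (r * x $ i))" for r
      using Re_levy_exponent(1)[OF \<nu>, of "r *\<^sub>R axis i 1"] unfolding inner .
    show "levy_basis.damping (\<lambda>r. levy_exponent \<gamma> S \<nu> (r *\<^sub>R axis i 1)) r =
        (axis i 1 \<bullet> (S *v axis i 1)) / 2 * r\<^sup>2 + (LINT x|\<nu>. 1 - cos (r * x $ i))" for r
      unfolding levy_basis.damping_def[OF basis] Re_levy_exponent(2)[OF \<nu>] inner
      by (simp add: inner_axis' matrix_vector_mult_scaleR power2_eq_square)
  qed
qed

section \<open>Coordinates of stochastic integrals\<close>

lemma tendsto_in_prob_component:
  fixes X :: "nat \<Rightarrow> 'a \<Rightarrow> real ^ 'n"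
  assumes "prob_space P" and lim: "tendsto_in_prob P X Y"
    and [measurable]: "\<And>n. X n \<in> borel_measurable P" "Y \<in> borel_measurable P"
  shows "tendsto_in_prob P (\<lambda>n \<omega>. X n \<omega> $ i) (\<lambda>\<omega>. Y \<omega> $ i)"
  unfolding tendsto_in_prob_def
proof (intro allI impI)
  interpret prob_space P by fact
  fix e :: real assume "e > 0"
  then have "(\<lambda>n. measure P {\<omega> \<in> space P. dist (X n \<omega>) (Y \<omega>) > e}) \<longlonglongrightarrow> 0"
    using lim by (simp add: tendsto_in_prob_def)
  then show "(\<lambda>n. measure P {\<omega> \<in> space P. dist (X n \<omega> $ i) (Y \<omega> $ i) > e}) \<longlonglongrightarrow> 0"
  proof (rule tendsto_sandwich[OF _ _ tendsto_const, rotated 2])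
    show "\<forall>\<^sub>F n in sequentially. measure P {\<omega> \<in> space P. dist (X n \<omega> $ i) (Y \<omega> $ i) > e} \<le>
        measure P {\<omega> \<in> space P. dist (X n \<omega>) (Y \<omega>) > e}"
    proof (intro always_eventually allI finite_measure_mono)
      fix n
      show "{\<omega> \<in> space P. dist (X n \<omega> $ i) (Y \<omega> $ i) > e} \<subseteq> {\<omega> \<in> space P. dist (X n \<omega>) (Y \<omega>) > e}"
        using dist_vec_nth_le[of "X n _" i "Y _"] by (auto intro: less_le_trans)
    qed measurable
  qed simp
qed

text \<open>The approximating simple functions of the vector integral serve every coordinate:
  \<open>integ\<close> is the coordinate of the simple integral, and passing to a coordinate does
  not increase distances.\<close>

lemma has_levy_integral_component:
  fixes L :: "real \<Rightarrow> 'a \<Rightarrow> real ^ 'n"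
  assumes L: "two_sided_levy_process P L \<gamma> S \<nu>" and \<Lambda>: "levy_random_measure P L \<Lambda>"
    and Y: "has_levy_integral P \<Lambda> UNIV f Y"
  obtains F where "\<And>n. simple_integrand (F n)" "AE t in lborel. (\<lambda>n. F n t) \<longlonglongrightarrow> f t"
    "\<And>B. B \<in> sets borel \<Longrightarrow> \<exists>Z\<in>borel_measurable P.
      tendsto_in_prob P (\<lambda>n. levy_basis.integ (\<lambda>B \<omega>. \<Lambda> B \<omega> $ i) B (F n)) Z"
    "tendsto_in_prob P (\<lambda>n. levy_basis.integ (\<lambda>B \<omega>. \<Lambda> B \<omega> $ i) UNIV (F n)) (\<lambda>\<omega>. Y \<omega> $ i)"
    "(\<lambda>\<omega>. Y \<omega> $ i) \<in> borel_measurable P"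
proof -
  interpret levy_basis_jumps P "\<lambda>B \<omega>. \<Lambda> B \<omega> $ i" "\<lambda>r. levy_exponent \<gamma> S \<nu> (r *\<^sub>R axis i 1)" \<nu> "\<lambda>x. x $ i"
    "(axis i 1 \<bullet> (S *v axis i 1)) / 2"
    by (rule levy_basis_jumps_component[OF L \<Lambda>])
  have nth [measurable]: "(\<lambda>x. x $ i) \<in> borel_measurable (borel :: (real ^ 'n) measure)"
    by (intro borel_measurable_continuous_onI continuous_intros)
  obtain F where F: "\<And>n. simple_integrand (F n)" "AE t in lborel. (\<lambda>n. F n t) \<longlonglongrightarrow> f t"
    and Z: "\<And>B. B \<in> sets borel \<Longrightarrow> \<exists>Z\<in>borel_measurable P. tendsto_in_prob P (\<lambda>n. simple_levy_integral \<Lambda> B (F n)) Z"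
    and lim: "tendsto_in_prob P (\<lambda>n. simple_levy_integral \<Lambda> UNIV (F n)) Y"
    and [measurable]: "Y \<in> borel_measurable P"
    using Y unfolding has_levy_integral_def by blast
  have comp: "integ B G = (\<lambda>\<omega>. simple_levy_integral \<Lambda> B G \<omega> $ i)" for B G
    by (simp add: integ_def simple_levy_integral_def fun_eq_iff)
  have m: "simple_levy_integral \<Lambda> B (F n) \<in> borel_measurable P" if "B \<in> sets borel" for B n
  proof -
    have "F n -` {c} \<inter> B \<in> bounded_borel" if "c \<noteq> 0" for c
      using F(1)[of n] \<open>B \<in> sets borel\<close> that unfolding simple_integrand_def bounded_borel_def
      by (auto dest!: borel_measurable_simple_function intro: measurable_sets_borel elim!: bounded_subset)
    then have "\<Lambda> (F n -` {c} \<inter> B) \<in> borel_measurable P" if "c \<noteq> 0" for c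
      using \<Lambda> that by (simp add: levy_random_measure_def)
    then show ?thesis
      unfolding simple_levy_integral_def[abs_def]
      by (intro borel_measurable_sum borel_measurable_scaleR borel_measurable_const) auto
  qed
  show ?thesis
  proof (rule that[OF F])
    show "(\<lambda>\<omega>. Y \<omega> $ i) \<in> borel_measurable P"
      by measurable
    show "tendsto_in_prob P (\<lambda>n. integ UNIV (F n)) (\<lambda>\<omega>. Y \<omega> $ i)"
      unfolding comp by (rule tendsto_in_prob_component[OF prob_space_axioms lim m]) measurable
    fix B :: "real set" assume B: "B \<in> sets borel"
    obtain Z where [measurable]: "Z \<in> borel_measurable P" and Z: "tendsto_in_prob P (\<lambda>n. simple_levy_integral \<Lambda> B (F n)) Z"
      using Z[OF B] by blast
    have "tendsto_in_prob P (\<lambda>n. integ B (F n)) (\<lambda>\<omega>. Z \<omega> $ i)"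
      unfolding comp by (rule tendsto_in_prob_component[OF prob_space_axioms Z m[OF B]]) measurable
    then show "\<exists>Z\<in>borel_measurable P. tendsto_in_prob P (\<lambda>n. integ B (F n)) Z"
      by (intro bexI[of _ "\<lambda>\<omega>. Z \<omega> $ i"]) measurable
  qed
qed

section \<open>Fourier transforms of interval indicators\<close>

lemma indicator_fourier_interval:
  assumes "a < b" and "\<mu> \<noteq> 0"
  shows "Re (indicator_fourier {a..<b} \<mu>) = (sin (b * \<mu>) - sin (a * \<mu>)) / (sqrt (2 * pi) * \<mu>)"
    and "Im (indicator_fourier {a..<b} \<mu>) = (cos (b * \<mu>) - cos (a * \<mu>)) / (sqrt (2 * pi) * \<mu>)"
proof -
  \<comment> \<open>An antiderivative of the exponential, as \<open>\<i> / \<mu>\<close> is the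
    reciprocal of \<open>- \<i> * \<mu>\<close>.\<close>
  define E where "E x = exp (- \<i> * of_real \<mu> * of_real x) * (\<i> / of_real \<mu>)" for x :: real
  have "(E has_vector_derivative exp (- \<i> * of_real \<mu> * of_real x)) (at x within {a..b})" for x
    unfolding E_def
  proof (rule has_vector_derivative_real_field)
    show "((\<lambda>z. exp (- \<i> * of_real \<mu> * z) * (\<i> / of_real \<mu>)) has_field_derivative
        exp (- \<i> * of_real \<mu> * of_real x)) (at (of_real x))"
      using \<open>\<mu> \<noteq> 0\<close> by (auto intro!: derivative_eq_intros)
  qed
  then have "(LINT x|lborel. indicator {a..b} x *\<^sub>R exp (- \<i> * of_real \<mu> * of_real x)) = E b - E a"
    using \<open>a < b\<close> by (intro integral_FTC_Icc) (auto intro!: continuous_intros)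
  moreover have "(LINT x|lborel. indicator {a..<b} x *\<^sub>R exp (- \<i> * of_real \<mu> * of_real x)) =
      (LINT x|lborel. indicator {a..b} x *\<^sub>R exp (- \<i> * of_real \<mu> * of_real x))"
  proof (rule integral_cong_AE)
    show "AE x in lborel. indicator {a..<b} x *\<^sub>R exp (- \<i> * of_real \<mu> * of_real x) =
        indicator {a..b} x *\<^sub>R exp (- \<i> * of_real \<mu> * of_real x)"
      using AE_lborel_singleton[of b] by eventually_elim (auto simp: indicator_def)
  qed measurable
  ultimately have eq: "indicator_fourier {a..<b} \<mu> = of_real (1 / sqrt (2 * pi)) * (E b - E a)"
    by (simp add: indicator_fourier_def set_lebesgue_integral_def)
  have E_eq: "E x = Complex (sin (x * \<mu>) / \<mu>) (cos (x * \<mu>) / \<mu>)" for x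
    using \<open>\<mu> \<noteq> 0\<close> by (simp add: E_def complex_eq_iff Re_exp Im_exp Re_divide Im_divide power2_eq_square mult.commute)
  show "Re (indicator_fourier {a..<b} \<mu>) = (sin (b * \<mu>) - sin (a * \<mu>)) / (sqrt (2 * pi) * \<mu>)"
    "Im (indicator_fourier {a..<b} \<mu>) = (cos (b * \<mu>) - cos (a * \<mu>)) / (sqrt (2 * pi) * \<mu>)"
    unfolding eq E_eq by (simp_all add: diff_divide_distrib mult.commute)
qed

section \<open>The random content\<close>

text \<open>By continuity from the value 1 at 0. It supplies a nonzero frequency at which logarithms
  of moduli can be taken.\<close>

lemma (in prob_space) eventually_cf_scale_nonzero:
  assumes [measurable]: "X \<in> borel_measurable M"
  shows "\<forall>\<^sub>F r in at 0. cf M (\<lambda>\<omega>. r * X \<omega>) \<noteq> 0"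
proof -
  interpret D: real_distribution "distr M borel X"
    by (intro real_distribution_distr) measurable
  have "(char (distr M borel X) \<longlongrightarrow> 1) (at 0)"
    using D.isCont_char[of 0] by (simp add: isCont_def D.char_zero)
  then have "\<forall>\<^sub>F r in at 0. char (distr M borel X) r \<noteq> 0"
    by (rule tendsto_imp_eventually_ne) simp
  then show ?thesis
    by (simp add: cf_scale_eq_char)
qed

text \<open>The Riemann-Lebesgue lemma, here read off the explicit formulas: the numerators are at
  most 2 in absolute value.\<close>

lemma indicator_fourier_tendsto_0:
  assumes "a < b"
  shows "((\<lambda>t. Re (indicator_fourier {a..<b} t)) \<longlongrightarrow> 0) at_top"
    and "((\<lambda>t. Im (indicator_fourier {a..<b} t)) \<longlongrightarrow> 0) at_top"
proof -
  have lim: "((\<lambda>t. 2 / (sqrt (2 * pi) * t)) \<longlongrightarrow> 0) at_top"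
    by (rule tendsto_divide_0[OF tendsto_const]) (auto intro!: filterlim_at_top_imp_at_infinity filterlim_tendsto_pos_mult_at_top[OF tendsto_const] filterlim_ident)
  have bound: "\<bar>(u - v) / (sqrt (2 * pi) * t)\<bar> \<le> 2 / (sqrt (2 * pi) * t)"
    if "\<bar>u\<bar> \<le> 1" "\<bar>v\<bar> \<le> 1" "t > 0" for u v t :: real
  proof -
    have "\<bar>u - v\<bar> \<le> 2"
      using that by linarith
    then show ?thesis
      using that(3) by (simp add: abs_mult divide_right_mono)
  qed
  show "((\<lambda>t. Re (indicator_fourier {a..<b} t)) \<longlongrightarrow> 0) at_top"
  proof (rule Lim_null_comparison[OF _ lim])
    show "\<forall>\<^sub>F t in at_top. norm (Re (indicator_fourier {a..<b} t)) \<le> 2 / (sqrt (2 * pi) * t)"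
      using eventually_gt_at_top[of 0]
      by eventually_elim (simp only: indicator_fourier_interval(1)[OF assms] real_norm_def, rule bound, auto)
  qed
  show "((\<lambda>t. Im (indicator_fourier {a..<b} t)) \<longlongrightarrow> 0) at_top"
  proof (rule Lim_null_comparison[OF _ lim])
    show "\<forall>\<^sub>F t in at_top. norm (Im (indicator_fourier {a..<b} t)) \<le> 2 / (sqrt (2 * pi) * t)"
      using eventually_gt_at_top[of 0]
      by eventually_elim (simp only: indicator_fourier_interval(2)[OF assms] real_norm_def, rule bound, auto)
  qed
qed

lemma second_quadrant:
  assumes "t \<in> {2 * pi * real m + pi / 2<..<2 * pi * real m + pi}"
  shows "sin t > 0" "cos t < 0" "t > 0"
proof -
  define u where "u = t - 2 * pi * real m"
  have u: "pi / 2 < u" "u < pi"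
    using assms by (auto simp: u_def)
  have t: "t = u + 2 * real m * pi"
    by (simp add: u_def)
  have "sin t = sin u" "cos t = cos u"
    unfolding t sin_add cos_add by (simp_all only: sin_2npi cos_2npi mult_zero_right mult_1_right add_0_right diff_0_right)
  moreover have "sin u > 0"
    using u by (intro sin_gt_zero) auto
  moreover have "cos u < 0"
    using u cos_gt_zero_pi[of "pi - u"] by simp
  ultimately show "sin t > 0" "cos t < 0"
    by auto
  show "t > 0"
    using u by (simp add: t add_pos_nonneg)
qed

text \<open>The numerators are \<open>sin t\<close>, \<open>sin (2 * t) - sin t\<close> and
  \<open>cos (2 * t) - 1\<close>. In the open second quadrant \<open>sin t\<close> is positive and
  \<open>sin (2 * t)\<close> negative, so none of them vanishes.\<close>

lemma fourier_values_nonzero: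
  assumes "t \<in> {2 * pi * real m + pi / 2<..<2 * pi * real m + pi}"
  shows "Re (indicator_fourier {0..<1} t) \<noteq> 0" "Re (indicator_fourier {1..<2} t) \<noteq> 0"
    "Im (indicator_fourier {0..<2} t) \<noteq> 0"
proof -
  note t = second_quadrant[OF assms]
  have "sin t \<noteq> sin (2 * t)"
  proof -
    have "sin (2 * t) < 0"
      unfolding sin_double using mult_pos_neg[OF t(1,2)] by (simp add: mult.commute)
    then show ?thesis
      using t by linarith
  qed
  moreover have "cos (2 * t) \<noteq> 1"
    using t by (simp add: cos_double_sin)
  ultimately show "Re (indicator_fourier {0..<1} t) \<noteq> 0" "Re (indicator_fourier {1..<2} t) \<noteq> 0"
    "Im (indicator_fourier {0..<2} t) \<noteq> 0"
    using t by (auto simp: indicator_fourier_interval)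
qed

lemma atLeastLessThan_in_interval_ring: "a < b \<Longrightarrow> {a..<b} \<in> interval_ring"
  by (auto simp: interval_ring_def)

lemma borel_measurable_complex_vec:
  fixes f :: "'a \<Rightarrow> complex ^ 'n"
  assumes "(\<lambda>\<omega>. \<chi> i. Re (f \<omega> $ i)) \<in> borel_measurable P" "(\<lambda>\<omega>. \<chi> i. Im (f \<omega> $ i)) \<in> borel_measurable P"
  shows "f \<in> borel_measurable P"
proof -
  have "(\<lambda>\<omega>. (\<lambda>u v. \<chi> i. of_real (u $ i) + \<i> * of_real (v $ i)) (\<chi> i. Re (f \<omega> $ i)) (\<chi> i. Im (f \<omega> $ i)) :: complex ^ 'n)
      \<in> borel_measurable P"
    by (rule borel_measurable_continuous_Pair[OF assms]) (intro continuous_intros)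
  moreover have "(\<chi> i. of_real (Re (f \<omega> $ i)) + \<i> * of_real (Im (f \<omega> $ i))) = f \<omega>" for \<omega>
    by (simp add: vec_eq_iff complex_eq[symmetric])
  ultimately show ?thesis
    by simp
qed

text \<open>Vanishing of all coordinates concentrates \<nu> at the origin, which a Levy measure does
  not charge; then \<nu> is null, contrary to regular variation.\<close>

lemma not_AE_components_zero:
  fixes \<nu> :: "(real ^ 'n) measure"
  assumes "levy_measure \<nu>" and "regularly_varying_measure \<nu> \<alpha>"
    and zero: "\<And>i. AE x in \<nu>. x $ i = 0"
  shows False
proof -
  have sets: "sets \<nu> = sets borel" and "emeasure \<nu> {0} = 0"
    using assms(1) by (auto simp: levy_measure_def)
  then have "{0} \<in> null_sets \<nu>"
    by (auto simp: null_sets_def)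
  then have "AE x in \<nu>. x \<notin> {0}"
    by (rule AE_not_in)
  moreover have "AE x in \<nu>. \<forall>i. x $ i = 0"
    using zero by (simp add: eventually_all_finite)
  ultimately have "AE x in \<nu>. x \<notin> space \<nu>"
    by eventually_elim (auto simp: vec_eq_iff)
  then have "space \<nu> \<in> null_sets \<nu>"
    by (simp add: AE_iff_null_sets)
  then have "emeasure \<nu> (space \<nu>) = 0"
    by (simp add: null_sets_def)
  then show False
    using regularly_varying_measure_nonzero[OF assms(2)] sets_eq_imp_space_eq[OF sets] by simp
qed

section \<open>Consequences of the two scattering properties\<close>

context
  fixes P :: "'a measure" and L :: "real \<Rightarrow> 'a \<Rightarrow> real ^ 'n"
    and \<gamma> :: "real ^ 'n" and S :: "real ^ 'n ^ 'n" and \<nu> :: "(real ^ 'n) measure"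
    and \<Lambda> :: "real set \<Rightarrow> 'a \<Rightarrow> real ^ 'n" and M :: "real set \<Rightarrow> 'a \<Rightarrow> complex ^ 'n"
  assumes L: "two_sided_levy_process P L \<gamma> S \<nu>" and \<Lambda>: "levy_random_measure P L \<Lambda>"
    and M: "\<forall>A\<in>interval_ring. \<exists>Y. has_complex_levy_integral P \<Lambda> UNIV (indicator_fourier A) Y \<and>
      M A = (\<lambda>\<omega>. (1 / sqrt (2 * pi)) *\<^sub>R Y \<omega>)"
begin

text \<open>The factor undoes the normalization in the definition of the content, so that real and
  imaginary parts of \<open>M A\<close> are themselves exhibited as integrals.\<close>

lemma has_levy_integral_M:
  assumes "A \<in> interval_ring"
  shows "has_levy_integral P \<Lambda> UNIV (\<lambda>t. Re (indicator_fourier A t)) (\<lambda>\<omega>. sqrt (2 * pi) *\<^sub>R (\<chi> i. Re (M A \<omega> $ i)))"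
    and "has_levy_integral P \<Lambda> UNIV (\<lambda>t. Im (indicator_fourier A t)) (\<lambda>\<omega>. sqrt (2 * pi) *\<^sub>R (\<chi> i. Im (M A \<omega> $ i)))"
proof -
  obtain Y where Y: "has_complex_levy_integral P \<Lambda> UNIV (indicator_fourier A) Y"
    and MA: "M A = (\<lambda>\<omega>. (1 / sqrt (2 * pi)) *\<^sub>R Y \<omega>)"
    using M assms by blast
  have "sqrt (2 * pi) *\<^sub>R (\<chi> i. Re (M A \<omega> $ i)) = (\<chi> i. Re (Y \<omega> $ i))"
    "sqrt (2 * pi) *\<^sub>R (\<chi> i. Im (M A \<omega> $ i)) = (\<chi> i. Im (Y \<omega> $ i))" for \<omega>
    by (simp_all add: MA vec_eq_iff)
  then show "has_levy_integral P \<Lambda> UNIV (\<lambda>t. Re (indicator_fourier A t)) (\<lambda>\<omega>. sqrt (2 * pi) *\<^sub>R (\<chi> i. Re (M A \<omega> $ i)))"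
    "has_levy_integral P \<Lambda> UNIV (\<lambda>t. Im (indicator_fourier A t)) (\<lambda>\<omega>. sqrt (2 * pi) *\<^sub>R (\<chi> i. Im (M A \<omega> $ i)))"
    using Y by (simp_all add: has_complex_levy_integral_def)
qed

lemma M_measurable:
  assumes "A \<in> interval_ring"
  shows "M A \<in> borel_measurable P"
proof -
  have *: "V \<in> borel_measurable P" if "(\<lambda>\<omega>. sqrt (2 * pi) *\<^sub>R V \<omega>) \<in> borel_measurable P" for V :: "'a \<Rightarrow> real ^ 'n"
    using borel_measurable_const_scaleR[OF that, of "1 / sqrt (2 * pi)"] by simp
  show ?thesis
    by (rule borel_measurable_complex_vec; rule *)
      (use has_levy_integral_M[OF assms] in \<open>simp_all only: has_levy_integral_def\<close>)
qed

lemma AE_component_zero_of_independently_scattered: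
  assumes "independently_scattered P M"
  shows "AE x in \<nu>. x $ i = 0"
proof -
  interpret levy_basis_jumps P "\<lambda>B \<omega>. \<Lambda> B \<omega> $ i" "\<lambda>r. levy_exponent \<gamma> S \<nu> (r *\<^sub>R axis i 1)" \<nu> "\<lambda>x. x $ i"
    "(axis i 1 \<bullet> (S *v axis i 1)) / 2"
    by (rule levy_basis_jumps_component[OF L \<Lambda>])
  define A where "A k = {real k..<real k + 1}" for k
  define X where "X k \<omega> = (sqrt (2 * pi) *\<^sub>R (\<chi> i. Re (M (A k) \<omega> $ i))) $ i" for k \<omega>
  have A: "A k \<in> interval_ring" for k
    by (simp add: A_def atLeastLessThan_in_interval_ring)
  have "disjoint_family_on A {..<2}"
    by (auto simp: disjoint_family_on_def A_def less_2_cases_iff)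
  then have "indep_vars (\<lambda>_. borel) (\<lambda>k. M (A k)) {..<2}"
    using assms A unfolding independently_scattered_def by blast
  \<comment> \<open>The weights \<open>c\<close> carry the frequencies \<open>p\<close> and
    \<open>q\<close> of the joint characteristic function.\<close>
  then have "indep_vars (\<lambda>_. borel) (\<lambda>k \<omega>. c k * (sqrt (2 * pi) * Re (M (A k) \<omega> $ i))) {..<2}" for c :: "nat \<Rightarrow> real"
    by (rule indep_vars_compose2) (intro borel_measurable_continuous_onI continuous_intros)
  from cf_sum[OF this]
  have sum: "cf P (\<lambda>\<omega>. \<Sum>k<2. c k * X k \<omega>) = (\<Prod>k<2. cf P (\<lambda>\<omega>. c k * X k \<omega>))" for c :: "nat \<Rightarrow> real"
    by (simp add: X_def)
  have indep: "cf P (\<lambda>\<omega>. p * X 0 \<omega> + q * X 1 \<omega>) = cf P (\<lambda>\<omega>. p * X 0 \<omega>) * cf P (\<lambda>\<omega>. q * X 1 \<omega>)" for p q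
    using sum[of "\<lambda>k. if k = 0 then p else q"] by (simp add: numeral_2_eq_2)
  obtain F where F: "\<And>n. simple_integrand (F n)" "AE t in lborel. (\<lambda>n. F n t) \<longlonglongrightarrow> Re (indicator_fourier (A 0) t)"
    and X0: "tendsto_in_prob P (\<lambda>n. integ UNIV (F n)) (X 0)" "X 0 \<in> borel_measurable P"
    unfolding X_def[abs_def] by (rule has_levy_integral_component[OF L \<Lambda> has_levy_integral_M(1)[OF A[of 0]], of i]) blast
  obtain G where G: "\<And>n. simple_integrand (G n)" "AE t in lborel. (\<lambda>n. G n t) \<longlonglongrightarrow> Re (indicator_fourier (A 1) t)"
    and X1: "tendsto_in_prob P (\<lambda>n. integ UNIV (G n)) (X 1)" "X 1 \<in> borel_measurable P"
    unfolding X_def[abs_def] by (rule has_levy_integral_component[OF L \<Lambda> has_levy_integral_M(1)[OF A[of 1]], of i]) blast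
  have "\<forall>\<^sub>F r in at 0. r \<noteq> 0 \<and> cf P (\<lambda>\<omega>. r * X 0 \<omega>) \<noteq> 0 \<and> cf P (\<lambda>\<omega>. r * X 1 \<omega>) \<noteq> 0"
    using X0(2) X1(2) by (intro eventually_conj eventually_cf_scale_nonzero) (simp add: eventually_at_filter)
  then obtain r where r: "r \<noteq> 0" "cf P (\<lambda>\<omega>. r * X 0 \<omega>) \<noteq> 0" "cf P (\<lambda>\<omega>. r * X 1 \<omega>) \<noteq> 0"
    using eventually_happens'[OF at_neq_bot] by blast
  have A_eq: "A 0 = {0..<1}" "A 1 = {1..<2}"
    by (auto simp: A_def)
  have ae: "AE t in lborel. AE x in \<nu>. (1 - cos (r * Re (indicator_fourier (A 0) t) * x $ i)) *
      (1 - cos (r * Re (indicator_fourier (A 1) t) * x $ i)) = 0"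
    by (rule AE_AE_of_indep[OF F(1) G(1) F(2) G(2) X0(1) X1(1) X0(2) X1(2) indep r(2,3)])
  show ?thesis
  proof (rule AE_zero_of_one_minus_cos_product[OF ae])
    show "((\<lambda>t. r * Re (indicator_fourier (A 0) t)) \<longlongrightarrow> 0) at_top" "((\<lambda>t. r * Re (indicator_fourier (A 1) t)) \<longlongrightarrow> 0) at_top"
      unfolding A_eq by (intro tendsto_mult_right_zero indicator_fourier_tendsto_0; simp)+
    fix m t assume "t \<in> {2 * pi * real m + pi / 2<..<2 * pi * real m + pi}"
    then show "r * Re (indicator_fourier (A 0) t) \<noteq> 0 \<and> r * Re (indicator_fourier (A 1) t) \<noteq> 0"
      unfolding A_eq using r(1) by (simp add: fourier_values_nonzero)
  qed
qed

text \<open>A shift by 1 takes \<open>{-1..<1}\<close> to \<open>{0..<2}\<close>. The first set has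
  a real transform, the cosine being even, so \<open>norm_cf_limit_eq_1\<close> gives modulus 1 for
  its imaginary part; equality of laws transfers this to the second set.\<close>

lemma AE_component_zero_of_stationarily_scattered:
  assumes "stationarily_scattered P M"
  shows "AE x in \<nu>. x $ i = 0"
proof -
  interpret levy_basis_jumps P "\<lambda>B \<omega>. \<Lambda> B \<omega> $ i" "\<lambda>r. levy_exponent \<gamma> S \<nu> (r *\<^sub>R axis i 1)" \<nu> "\<lambda>x. x $ i"
    "(axis i 1 \<bullet> (S *v axis i 1)) / 2"
    by (rule levy_basis_jumps_component[OF L \<Lambda>])
  have ring: "{-1..<1::real} \<in> interval_ring" "{0..<2::real} \<in> interval_ring"
    by (simp_all add: atLeastLessThan_in_interval_ring)
  define X where "X A \<omega> = (sqrt (2 * pi) *\<^sub>R (\<chi> i. Im (M A \<omega> $ i))) $ i" for A \<omega>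
  \<comment> \<open>Stationarity compares laws on product spaces, so the characteristic function is
    written as an integral over a product with one factor.\<close>
  have cf_X: "cf P (\<lambda>\<omega>. r * X A \<omega>) =
      (CLINT w|distr P (\<Pi>\<^sub>M k\<in>{..<1::nat}. borel) (\<lambda>\<omega>. \<lambda>k\<in>{..<1}. M A \<omega>). iexp (r * (sqrt (2 * pi) * Im (w 0 $ i))))"
    if "A \<in> interval_ring" for r A
  proof -
    have [measurable]: "M A \<in> borel_measurable P"
      by (rule M_measurable[OF that])
    have [measurable]: "(\<lambda>z. Im (z $ i)) \<in> borel_measurable (borel :: (complex ^ 'n) measure)"
      by (intro borel_measurable_continuous_onI continuous_intros)
    have m: "(\<lambda>w. w 0) \<in> measurable (\<Pi>\<^sub>M k\<in>{..<1::nat}. (borel :: (complex ^ 'n) measure)) borel"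
      by (rule measurable_component_singleton) simp
    have "(\<lambda>w. Im (w 0 $ i)) \<in> borel_measurable (\<Pi>\<^sub>M k\<in>{..<1::nat}. (borel :: (complex ^ 'n) measure))"
      by (rule measurable_compose[OF m]) measurable
    then have "(\<lambda>w. iexp (r * (sqrt (2 * pi) * Im (w 0 $ i)))) \<in>
        borel_measurable (\<Pi>\<^sub>M k\<in>{..<1::nat}. (borel :: (complex ^ 'n) measure))"
      by measurable
    then show ?thesis
      by (subst integral_distr) (auto simp: cf_def X_def intro!: measurable_restrict)
  qed
  have "(\<lambda>x. x + 1) ` {-1..<1::real} = {0..<2}"
    by (subst image_add_atLeastLessThan') simp
  then have "distr P (\<Pi>\<^sub>M k\<in>{..<1::nat}. borel) (\<lambda>\<omega>. \<lambda>k\<in>{..<1}. M {-1..<1} \<omega>) =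
      distr P (\<Pi>\<^sub>M k\<in>{..<1::nat}. borel) (\<lambda>\<omega>. \<lambda>k\<in>{..<1}. M {0..<2} \<omega>)"
    using assms[unfolded stationarily_scattered_def, rule_format, of 1 "\<lambda>_. {-1..<1}" 1] ring by simp
  then have cf_eq: "cf P (\<lambda>\<omega>. r * X {-1..<1} \<omega>) = cf P (\<lambda>\<omega>. r * X {0..<2} \<omega>)" for r
    using ring by (simp add: cf_X)
  obtain F where F: "\<And>n. simple_integrand (F n)" "AE t in lborel. (\<lambda>n. F n t) \<longlonglongrightarrow> Im (indicator_fourier {-1..<1} t)"
    "\<And>B. B \<in> sets borel \<Longrightarrow> \<exists>Z\<in>borel_measurable P. tendsto_in_prob P (\<lambda>n. integ B (F n)) Z"
    and X0: "tendsto_in_prob P (\<lambda>n. integ UNIV (F n)) (X {-1..<1})" "X {-1..<1} \<in> borel_measurable P"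
    unfolding X_def[abs_def] by (rule has_levy_integral_component[OF L \<Lambda> has_levy_integral_M(2)[OF ring(1)], of i]) blast
  obtain G where G: "\<And>n. simple_integrand (G n)" "AE t in lborel. (\<lambda>n. G n t) \<longlonglongrightarrow> Im (indicator_fourier {0..<2} t)"
    and X1: "tendsto_in_prob P (\<lambda>n. integ UNIV (G n)) (X {0..<2})" "X {0..<2} \<in> borel_measurable P"
    unfolding X_def[abs_def] by (rule has_levy_integral_component[OF L \<Lambda> has_levy_integral_M(2)[OF ring(2)], of i]) blast
  have F0: "AE t in lborel. (\<lambda>n. F n t) \<longlonglongrightarrow> 0"
    using F(2) AE_lborel_singleton[of "0::real"]
    by eventually_elim (simp add: indicator_fourier_interval)
  have "\<forall>\<^sub>F r in at 0. r \<noteq> 0 \<and> cf P (\<lambda>\<omega>. r * X {-1..<1} \<omega>) \<noteq> 0"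
    using X0(2) by (intro eventually_conj eventually_cf_scale_nonzero) (simp add: eventually_at_filter)
  then obtain r where r: "r \<noteq> 0" "cf P (\<lambda>\<omega>. r * X {-1..<1} \<omega>) \<noteq> 0"
    using eventually_happens'[OF at_neq_bot] by blast
  have "cmod (cf P (\<lambda>\<omega>. r * X {-1..<1} \<omega>)) = 1"
    by (rule norm_cf_limit_eq_1[OF F(1) F0 F(3) X0 r(2)])
  then have "cmod (cf P (\<lambda>\<omega>. r * X {0..<2} \<omega>)) = 1"
    by (simp only: cf_eq)
  then have "AE t in lborel. AE x in \<nu>. 1 - cos (r * Im (indicator_fourier {0..<2} t) * x $ i) = 0"
    by (rule AE_AE_of_norm_cf_eq_1[OF G(1,2) X1])
  \<comment> \<open>Squaring the factor allows the lemma on cosine products to be reused with both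
    functions equal.\<close>
  then have ae: "AE t in lborel. AE x in \<nu>. (1 - cos (r * Im (indicator_fourier {0..<2} t) * x $ i)) *
      (1 - cos (r * Im (indicator_fourier {0..<2} t) * x $ i)) = 0"
    by simp
  have lim: "((\<lambda>t. r * Im (indicator_fourier {0..<2} t)) \<longlongrightarrow> 0) at_top"
    by (intro tendsto_mult_right_zero indicator_fourier_tendsto_0) simp
  show ?thesis
  proof (rule AE_zero_of_one_minus_cos_product[OF ae lim lim])
    fix m t assume "t \<in> {2 * pi * real m + pi / 2<..<2 * pi * real m + pi}"
    then show "r * Im (indicator_fourier {0..<2} t) \<noteq> 0 \<and> r * Im (indicator_fourier {0..<2} t) \<noteq> 0"
      using r(1) by (simp add: fourier_values_nonzero)
  qed
qed

end

theorem theorem3p7: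
  fixes P :: "'a measure"
    and L :: "real \<Rightarrow> 'a \<Rightarrow> real ^ 'n"
    and \<gamma> :: "real ^ 'n" and S :: "real ^ 'n ^ 'n" and \<nu> :: "(real ^ 'n) measure"
    and \<alpha> :: real
    and M :: "real set \<Rightarrow> 'a \<Rightarrow> complex ^ 'n"
  assumes "two_sided_levy_process P L \<gamma> S \<nu>"
    and "integrable P (L 1)" and "(LINT \<omega>|P. L 1 \<omega>) = 0"
    and "regularly_varying_measure \<nu> \<alpha>" and "1 < \<alpha>" and "\<alpha> \<le> 2"
    and "levy_fourier_content P L M"
  shows "\<not> independently_scattered P M \<and> \<not> stationarily_scattered P M"
proof -
  obtain \<Lambda> where \<Lambda>: "levy_random_measure P L \<Lambda>"
    and M: "\<forall>A\<in>interval_ring. \<exists>Y. has_complex_levy_integral P \<Lambda> UNIV (indicator_fourier A) Y \<and>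
      M A = (\<lambda>\<omega>. (1 / sqrt (2 * pi)) *\<^sub>R Y \<omega>)"
    using assms(7) unfolding levy_fourier_content_def by blast
  have \<nu>: "levy_measure \<nu>"
    using assms(1) by (simp add: two_sided_levy_process_def generating_triplet_def)
  show ?thesis
  proof (intro conjI notI)
    assume "independently_scattered P M"
    then have "AE x in \<nu>. x $ i = 0" for i
      by (rule AE_component_zero_of_independently_scattered[OF assms(1) \<Lambda> M])
    then show False
      by (rule not_AE_components_zero[OF \<nu> assms(4)])
  next
    assume "stationarily_scattered P M"
    then have "AE x in \<nu>. x $ i = 0" for i
      by (rule AE_component_zero_of_stationarily_scattered[OF assms(1) \<Lambda> M])
    then show False
      by (rule not_AE_components_zero[OF \<nu> assms(4)])
  qed
qed

end
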